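(* For every $n\ge3$ there is a Lipschitz monotone function $U:(-2,2)^n\to\mathbb R$ such that, for every $t\in(-1,1)$, the point $P_t=(0,t,t,0,\ldots,0)\in\mathbb R^n$ lies in the level set $U^{-1}(t)$ and $U^{-1}(t)$ has no topological manifold neighborhood at $P_t$. Nevertheless, there are smooth monotone functions $U_N$ on $(-2,2)^n$, $N\in\mathbb N$, such that $U_N\to U$ uniformly and strongly in $W^{1,p}((-2,2)^n)$ for every $1\le p<\infty$. Moreover, almost every level of $U$ has finite $\mathcal H^{n-1}$ measure, i.e. $\mathcal H^{n-1}(U^{-1}(t))<\infty$ for almost every $t\in\mathbb R$.
   Context: A continuous function $f:\Omega\to\mathbb R$ on an open set $\Omega\subset\mathbb R^n$ is monotone (in the sense of Lebesgue) if $\max_{\overline V}f=\max_{\partial V}f$ and $\min_{\overline V}f=\min_{\partial V}f$ for every nonempty open $V$ with $\overline V$ compact and contained in $\Omega$. "No topological manifold neighborhood at $P_t$" means that $P_t$ has no neighborhood in the subspace $U^{-1}(t)$ that is homeomorphic to an open Euclidean ball or to a relatively open ball in a Euclidean half-space (of any dimension); that is, intrinsic charts with or without boundary are excluded. $\mathcal H^{n-1}$ is $(n-1)$-dimensional Hausdorff measure. *)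

theory Defs
  imports "HOL-Analysis.Analysis"
begin

(* For continuous f both suprema (infima) are attained: closure V and frontier V are compact, and
   frontier V is nonempty, since a nonempty bounded open set is never closed. *)
definition lebesgue_monotone_on :: "'a::euclidean_space set \<Rightarrow> ('a \<Rightarrow> real) \<Rightarrow> bool" where
  "lebesgue_monotone_on \<Omega> f \<longleftrightarrow>
     continuous_on \<Omega> f \<and>
     (\<forall>V. open V \<and> V \<noteq> {} \<and> compact (closure V) \<and> closure V \<subseteq> \<Omega> \<longrightarrow>
        Sup (f ` closure V) = Sup (f ` frontier V) \<and>
        Inf (f ` closure V) = Inf (f ` frontier V))"

(* Meaningful on open sets only: derivatives are taken in the full space. *)
primrec Ck_on :: "nat \<Rightarrow> 'a::euclidean_space set \<Rightarrow> ('a \<Rightarrow> real) \<Rightarrow> bool" where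
  "Ck_on 0 \<Omega> f \<longleftrightarrow> continuous_on \<Omega> f"
| "Ck_on (Suc k) \<Omega> f \<longleftrightarrow>
     (\<forall>x\<in>\<Omega>. f differentiable at x) \<and>
     (\<forall>v. Ck_on k \<Omega> (\<lambda>x. frechet_derivative f (at x) v))"

definition smooth_on :: "'a::euclidean_space set \<Rightarrow> ('a \<Rightarrow> real) \<Rightarrow> bool" where
  "smooth_on \<Omega> f \<longleftrightarrow> (\<forall>k. Ck_on k \<Omega> f)"

definition test_function :: "'a::euclidean_space set \<Rightarrow> ('a \<Rightarrow> real) \<Rightarrow> bool" where
  "test_function \<Omega> \<phi> \<longleftrightarrow>
     smooth_on UNIV \<phi> \<and> compact (closure {x. \<phi> x \<noteq> 0}) \<and> closure {x. \<phi> x \<noteq> 0} \<subseteq> \<Omega>"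

definition locally_integrable_on ::
    "'a::euclidean_space set \<Rightarrow> ('a \<Rightarrow> 'b::euclidean_space) \<Rightarrow> bool" where
  "locally_integrable_on \<Omega> f \<longleftrightarrow>
     (\<forall>K. compact K \<and> K \<subseteq> \<Omega> \<longrightarrow> integrable (lebesgue_on K) f)"

definition weak_gradient_on ::
    "'a::euclidean_space set \<Rightarrow> ('a \<Rightarrow> real) \<Rightarrow> ('a \<Rightarrow> 'a) \<Rightarrow> bool" where
  "weak_gradient_on \<Omega> f G \<longleftrightarrow>
     locally_integrable_on \<Omega> f \<and> locally_integrable_on \<Omega> G \<and>
     (\<forall>\<phi>. test_function \<Omega> \<phi> \<longrightarrow> (\<forall>b\<in>Basis.
        (LINT x|lebesgue_on \<Omega>. f x * frechet_derivative \<phi> (at x) b)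
          = - (LINT x|lebesgue_on \<Omega>. (G x \<bullet> b) * \<phi> x)))"

definition in_Lp :: "real \<Rightarrow> 'a::euclidean_space set \<Rightarrow> ('a \<Rightarrow> 'b::euclidean_space) \<Rightarrow> bool" where
  "in_Lp p \<Omega> f \<longleftrightarrow>
     f \<in> borel_measurable (lebesgue_on \<Omega>) \<and>
     integrable (lebesgue_on \<Omega>) (\<lambda>x. norm (f x) powr p)"

definition Lp_norm :: "real \<Rightarrow> 'a::euclidean_space set \<Rightarrow> ('a \<Rightarrow> 'b::euclidean_space) \<Rightarrow> real" where
  "Lp_norm p \<Omega> f = (LINT x|lebesgue_on \<Omega>. norm (f x) powr p) powr (1 / p)"

(* Strong (norm) convergence in the Sobolev space of exponent p, including membership of all
   functions involved. Weak gradients are unique up to null sets, so the choice of the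
   representatives G and g is immaterial. *)
definition W1p_tendsto ::
    "real \<Rightarrow> 'a::euclidean_space set \<Rightarrow> (nat \<Rightarrow> 'a \<Rightarrow> real) \<Rightarrow> ('a \<Rightarrow> real) \<Rightarrow> bool" where
  "W1p_tendsto p \<Omega> F f \<longleftrightarrow>
     (\<exists>G g.
        weak_gradient_on \<Omega> f g \<and> in_Lp p \<Omega> f \<and> in_Lp p \<Omega> g \<and>
        (\<forall>N. weak_gradient_on \<Omega> (F N) (G N) \<and> in_Lp p \<Omega> (F N) \<and> in_Lp p \<Omega> (G N)) \<and>
        (\<lambda>N. Lp_norm p \<Omega> (\<lambda>x. F N x - f x)) \<longlonglongrightarrow> 0 \<and>
        (\<lambda>N. Lp_norm p \<Omega> (\<lambda>x. G N x - g x)) \<longlonglongrightarrow> 0)"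

(* Normalised so that it agrees with Lebesgue measure when d is the dimension of the space.
   The boundedness condition is needed because diameter is unspecified on unbounded sets;
   the case distinction only matters for d = 0, where 0 ^ 0 = 1. *)
definition hausdorff_premeasure :: "nat \<Rightarrow> real \<Rightarrow> 'a::metric_space set \<Rightarrow> ennreal" where
  "hausdorff_premeasure d \<delta> A =
     (INF C \<in> {C :: nat \<Rightarrow> 'a set. A \<subseteq> (\<Union>i. C i) \<and> (\<forall>i. bounded (C i) \<and> diameter (C i) \<le> \<delta>)}.
        (\<Sum>i. if C i = {} then 0
              else ennreal (unit_ball_vol (real d) * (diameter (C i) / 2) ^ d)))"

definition hausdorff_measure :: "nat \<Rightarrow> 'a::metric_space set \<Rightarrow> ennreal" where
  "hausdorff_measure d A = (SUP \<delta>\<in>{0<..}. hausdorff_premeasure d \<delta> A)"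

definition euclidean_ball :: "nat \<Rightarrow> (nat \<Rightarrow> real) \<Rightarrow> real \<Rightarrow> (nat \<Rightarrow> real) set" where
  "euclidean_ball m c r = {x \<in> topspace (Euclidean_space m). (\<Sum>i<m. (x i - c i)\<^sup>2) < r\<^sup>2}"

definition manifold_model :: "nat \<Rightarrow> (nat \<Rightarrow> real) set \<Rightarrow> bool" where
  "manifold_model m B \<longleftrightarrow>
     (\<exists>c\<in>topspace (Euclidean_space m). \<exists>r>0.
        B = euclidean_ball m c r \<or>
        m \<ge> 1 \<and> c 0 \<ge> 0 \<and> B = {x \<in> euclidean_ball m c r. x 0 \<ge> 0})"

(* The neighborhood N need not be open. *)
definition has_manifold_neighborhood :: "'a topology \<Rightarrow> 'a \<Rightarrow> bool" where
  "has_manifold_neighborhood X p \<longleftrightarrow>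
     (\<exists>N W m B. openin X W \<and> p \<in> W \<and> W \<subseteq> N \<and> N \<subseteq> topspace X \<and> manifold_model m B \<and>
        subtopology X N homeomorphic_space subtopology (Euclidean_space m) B)"

definition cube :: "(real ^ 'n) set" where
  "cube = {x. \<forall>i. -2 < x $ i \<and> x $ i < 2}"

definition level_set :: "(real ^ 'n \<Rightarrow> real) \<Rightarrow> real \<Rightarrow> (real ^ 'n) set" where
  "level_set U t = {x \<in> cube. U x = t}"

(* An enumeration e of the index type, with indices 1, ..., n, fixes the order of the coordinates:
   the point is (0, t, t, 0, ..., 0). *)
definition marked_point :: "(nat \<Rightarrow> 'n) \<Rightarrow> real \<Rightarrow> real ^ 'n" where
  "marked_point e t = (\<chi> i. if i = e 2 \<or> i = e 3 then t else 0)"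

end

theory Submission
  imports Defs "HOL-Computational_Algebra.Polynomial"
begin

text \<open>
  In coordinates x, y, z, ... take U = y + (x + 2) * g, where g is the sum over k of
  2^-k * sin^2 (2^k y) * b (2^k (z - y)), with a smooth bump b \<ge> 0 supported in [1, 2].
  The supports of the summands are disjoint strips accumulating at z = y, so g is nonnegative and
  Lipschitz, and the partial sums are smooth, have uniformly bounded gradients, and together with
  their gradients are eventually constant at each point; dominated convergence gives strong convergence
  for all finite exponents. As g \<ge> 0, these functions are nondecreasing in x, and a function that is
  monotone along lines in a fixed direction is monotone in the sense of Lebesgue: follow the line
  until it leaves V.

  At P_t one has U = t. The zeros of sin^2 (2^k y) cut the strip of scale k into cells on whose boundary
  U = y. In a cell slightly below y = t the bump is large enough to reach the value t inside,
  while U = y < t on the boundary. So the part of the level in this cell is open and closed in the level.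
  These parts come arbitrarily close to P_t, so no neighborhood of P_t in the level is connected,
  whereas balls and half-balls are connected. The finiteness of the Hausdorff measure holds for
  almost every level of any Lipschitz function by Eilenberg's inequality.
\<close>

subsection \<open>Smooth functions and bumps\<close>

text \<open>Differentiability gives continuity at the lowest order, and the induction passes through
  the directional derivatives. The product rule relies on this: its terms contain an
  undifferentiated factor, known to be of order \<open>Suc k\<close> but required only to order
  \<open>k\<close>.\<close>

lemma Ck_on_Suc_imp: "Ck_on (Suc k) \<Omega> f \<Longrightarrow> Ck_on k \<Omega> f"
proof (induction k arbitrary: f)
  case 0
  then show ?case
    by (auto intro!: continuous_at_imp_continuous_on differentiable_imp_continuous_within)
next
  case (Suc k)
  show ?case
    unfolding Ck_on.simps(2)[of k]
    using Suc.prems Suc.IH by (auto simp del: Ck_on.simps(2) simp: Ck_on.simps(2)[of "Suc k"])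
qed

lemma Ck_on_subset: "Ck_on k S f \<Longrightarrow> T \<subseteq> S \<Longrightarrow> Ck_on k T f"
proof (induction k arbitrary: f)
  case (Suc k)
  then show ?case by (simp add: subset_iff)
qed (simp add: continuous_on_subset)

lemma Ck_on_const: "Ck_on k S (\<lambda>x. c)"
  by (induction k arbitrary: c) auto

lemma Ck_on_add:
  assumes "Ck_on k UNIV f" "Ck_on k UNIV g"
  shows "Ck_on k UNIV (\<lambda>x. f x + g x)"
  using assms
proof (induction k arbitrary: f g)
  case (Suc k)
  have "frechet_derivative (\<lambda>x. f x + g x) (at x) v
      = frechet_derivative f (at x) v + frechet_derivative g (at x) v" for x v
  proof -
    have "((\<lambda>x. f x + g x) has_derivative
        (\<lambda>v. frechet_derivative f (at x) v + frechet_derivative g (at x) v)) (at x)"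
      using Suc.prems by (intro has_derivative_add) (simp_all flip: frechet_derivative_works)
    then show ?thesis by (simp only: frechet_derivative_at[symmetric])
  qed
  then show ?case
    using Suc.prems by (simp add: Suc.IH)
qed (simp add: continuous_on_add)

lemma Ck_on_mult:
  assumes "Ck_on k UNIV f" "Ck_on k UNIV g"
  shows "Ck_on k UNIV (\<lambda>x. f x * g x)"
  using assms
proof (induction k arbitrary: f g)
  case (Suc k)
  have d: "f differentiable at x" "g differentiable at x" for x
    using Suc.prems by auto
  have "((\<lambda>x. f x * g x) has_derivative (\<lambda>v. f x * frechet_derivative g (at x) v
      + frechet_derivative f (at x) v * g x)) (at x)" for x
    using d by (intro has_derivative_mult) (simp_all flip: frechet_derivative_works)
  from frechet_derivative_at[OF this, symmetric]
  have "frechet_derivative (\<lambda>x. f x * g x) (at x) v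
      = f x * frechet_derivative g (at x) v + frechet_derivative f (at x) v * g x" for x v
    by simp
  then show ?case
    using Suc.prems d Ck_on_Suc_imp[OF Suc.prems(1)] Ck_on_Suc_imp[OF Suc.prems(2)]
    by (simp add: Ck_on_add Suc.IH)
qed (simp add: continuous_on_mult)

lemma Ck_on_sum:
  assumes "\<And>i. i \<in> I \<Longrightarrow> Ck_on k UNIV (f i)"
  shows "Ck_on k UNIV (\<lambda>x. \<Sum>i\<in>I. f i x)"
  using assms by (induction I rule: infinite_finite_induct) (auto intro: Ck_on_const Ck_on_add)

section \<open>Smooth functions of one real variable, given by a chain of derivatives\<close>

definition smooth_real :: "(real \<Rightarrow> real) \<Rightarrow> bool" where
  "smooth_real f \<longleftrightarrow>
     (\<exists>D. D 0 = f \<and> (\<forall>k x. (D k has_real_derivative D (Suc k) x) (at x)))"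

text \<open>By the chain rule, the derivative of \<open>D i (x \<bullet> v)\<close> in direction
  \<open>h\<close> is \<open>D (Suc i) (x \<bullet> v)\<close> times the constant
  \<open>h \<bullet> v\<close>. The induction on the order therefore treats all members
  \<open>D i\<close> of the chain at once.\<close>

lemma Ck_on_smooth_real_inner:
  fixes v :: "'a::euclidean_space"
  assumes "smooth_real f"
  shows "Ck_on k UNIV (\<lambda>x. f (x \<bullet> v))"
proof -
  obtain D where D: "D 0 = f" "\<And>k x. (D k has_real_derivative D (Suc k) x) (at x)"
    using assms unfolding smooth_real_def by auto
  have der: "((\<lambda>x. D i (x \<bullet> v)) has_derivative (\<lambda>h. D (Suc i) (x \<bullet> v) * (h \<bullet> v))) (at x)" for i x
    using has_derivative_compose[OF _ D(2)[of i, unfolded has_field_derivative_def],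
        of "\<lambda>x. x \<bullet> v" "\<lambda>h. h \<bullet> v" x UNIV] has_derivative_inner_left[OF has_derivative_ident]
    by auto
  have fr: "frechet_derivative (\<lambda>x. D i (x \<bullet> v)) (at x) = (\<lambda>h. D (Suc i) (x \<bullet> v) * (h \<bullet> v))" for i x
    using frechet_derivative_at[OF der] by simp
  have "Ck_on k UNIV (\<lambda>x. D i (x \<bullet> v))" for i
  proof (induction k arbitrary: i)
    case 0
    show ?case
      using der by (auto intro!: continuous_at_imp_continuous_on has_derivative_continuous)
  next
    case (Suc k)
    show ?case
      using der Ck_on_mult[OF Suc Ck_on_const] unfolding Ck_on.simps fr differentiable_def by blast
  qed
  from this[of 0] D show ?thesis by simp
qed

lemma smooth_real_has_derivative:
  assumes "smooth_real f"
  obtains f' where "\<And>x. (f has_real_derivative f' x) (at x)" "continuous_on UNIV f'"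
proof -
  obtain D where D: "D 0 = f" "\<And>k x. (D k has_real_derivative D (Suc k) x) (at x)"
    using assms unfolding smooth_real_def by auto
  show ?thesis
  proof
    show "(f has_real_derivative D 1 x) (at x)" for x using D(2)[of 0 x] D(1) by simp
    show "continuous_on UNIV (D 1)"
      using D(2) by (meson DERIV_isCont continuous_at_imp_continuous_on)
  qed
qed

text \<open>A choice function \<open>d\<close> picks for each member a derivative that is again a
  member, and the iterates of \<open>d\<close> form the required chain. Smoothness is thus reduced
  to finding a class of functions closed under differentiation.\<close>

lemma smooth_real_family:
  assumes "f \<in> F" "\<And>g. g \<in> F \<Longrightarrow> \<exists>h\<in>F. \<forall>x. (g has_real_derivative h x) (at x)"
  shows "smooth_real f"
proof -
  obtain d where d: "\<And>g. g \<in> F \<Longrightarrow> d g \<in> F \<and> (\<forall>x. (g has_real_derivative d g x) (at x))"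
    using assms(2) by metis
  have *: "(d ^^ k) f \<in> F" for k
    by (induction k) (use assms(1) d in auto)
  show ?thesis
    unfolding smooth_real_def
    by (rule exI[of _ "\<lambda>k. (d ^^ k) f"]) (use d * in auto)
qed

text \<open>The linear combinations of \<open>sin (c * x)\<close> and \<open>cos (c * x)\<close>
  form a class closed under differentiation.\<close>

lemma smooth_real_sin: "smooth_real (\<lambda>x. sin (c * x))"
proof -
  let ?S = "\<lambda>(a, b) x. a * sin (c * x) + b * cos (c * x)"
  let ?F = "range ?S"
  show ?thesis
  proof (rule smooth_real_family[of _ ?F])
    have "(\<lambda>x. sin (c * x)) = ?S (1, 0)" by simp
    then show "(\<lambda>x. sin (c * x)) \<in> ?F" by (rule range_eqI)
    fix g assume "g \<in> ?F"
    then obtain a b where g: "g = (\<lambda>x. a * sin (c * x) + b * cos (c * x))" by auto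
    have "(g has_real_derivative ?S (- b * c, a * c) x) (at x)" for x
      unfolding g by (auto intro!: derivative_eq_intros)
    then show "\<exists>h\<in>?F. \<forall>x. (g has_real_derivative h x) (at x)"
      by (intro bexI[of _ "?S (- b * c, a * c)"] allI rangeI)
  qed
qed

section \<open>The flat functions p(1/x) exp(-1/x), extended by 0, and a bump on (1, 2)\<close>

definition exp_poly :: "real poly \<Rightarrow> real \<Rightarrow> real" where
  "exp_poly p x = (if x \<le> 0 then 0 else poly p (1 / x) * exp (- (1 / x)))"

text \<open>The substitution y = 1/x turns this into the decay of a polynomial in y against exp(-y)
  at infinity.\<close>

lemma exp_poly_tendsto_0: "(exp_poly p \<longlongrightarrow> 0) (at_right 0)"
proof -
  have "((\<lambda>y. poly p y * exp (- y)) \<longlongrightarrow> 0) at_top"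
  proof -
    have "((\<lambda>y. \<Sum>i\<le>degree p. coeff p i * (y ^ i / exp y)) \<longlongrightarrow> (\<Sum>i\<le>degree p. coeff p i * 0)) at_top"
      by (intro tendsto_intros tendsto_power_div_exp_0)
    then show ?thesis
      by (simp add: poly_altdef exp_minus sum_distrib_right divide_inverse mult.assoc)
  qed
  then have "((\<lambda>x. poly p (inverse x) * exp (- inverse x)) \<longlongrightarrow> 0) (at_right 0)"
    by (rule filterlim_compose) (rule filterlim_inverse_at_top_right)
  then show ?thesis
    by (rule Lim_transform_eventually)
       (auto simp: eventually_at_right_field exp_poly_def inverse_eq_divide intro: exI[of _ 1])
qed

text \<open>For x > 0, differentiating in y = 1/x gives (p' - p) exp(-y), and the inner derivative
  is -y^2; this accounts for the factor \<open>[:0, 0, 1:]\<close> and the sign. So differentiation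
  stays inside the class, with a new polynomial.\<close>

lemma exp_poly_has_derivative:
  "(exp_poly p has_real_derivative exp_poly ([:0, 0, 1:] * (p - pderiv p)) x) (at x)"
proof (cases "x = 0")
  case False
  show ?thesis
  proof (cases "x < 0")
    case True
    have "((\<lambda>x. 0) has_real_derivative exp_poly ([:0, 0, 1:] * (p - pderiv p)) x) (at x)"
      using True by (simp add: exp_poly_def)
    then show ?thesis
      by (rule has_field_derivative_transform_within_open[where S = "{..<0}"])
         (use True in \<open>auto simp: exp_poly_def\<close>)
  next
    case F: False
    then have x: "x > 0" using False by auto
    have "((\<lambda>x. poly p (1 / x) * exp (- (1 / x))) has_real_derivative
       exp_poly ([:0, 0, 1:] * (p - pderiv p)) x) (at x)"
      using x by (auto intro!: derivative_eq_intros DERIV_chain'[OF _ poly_DERIV]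
          simp: exp_poly_def field_simps power2_eq_square)
    then show ?thesis
      by (rule has_field_derivative_transform_within_open[where S = "{0<..}"])
         (use x in \<open>auto simp: exp_poly_def\<close>)
  qed
next
  case True
  have "((\<lambda>h. (exp_poly p (0 + h) - exp_poly p 0) / h) \<longlongrightarrow> 0) (at 0)"
    unfolding filterlim_at_split
  proof
    show "((\<lambda>h. (exp_poly p (0 + h) - exp_poly p 0) / h) \<longlongrightarrow> 0) (at_left 0)"
      by (rule Lim_transform_eventually[OF tendsto_const])
         (auto simp: eventually_at_left_field exp_poly_def intro: exI[of _ "-1"])
    \<comment> \<open>Division by \<open>h\<close> multiplies the polynomial in 1/h by its variable,
      so the difference quotient is itself a flat function.\<close>
    show "((\<lambda>h. (exp_poly p (0 + h) - exp_poly p 0) / h) \<longlongrightarrow> 0) (at_right 0)"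
      by (rule Lim_transform_eventually[OF exp_poly_tendsto_0[of "[:0, 1:] * p"]])
         (auto simp: eventually_at_right_field exp_poly_def intro: exI[of _ 1])
  qed
  then show ?thesis using True by (simp add: DERIV_def exp_poly_def)
qed

text \<open>A flat function of s - 1 times a flat function of 2 - s vanishes outside (1, 2). By the
  Leibniz rule, finite sums of such products form a class closed under differentiation; the sums are
  indexed by lists of pairs of polynomials.\<close>

lemma smooth_bump:
  obtains b :: "real \<Rightarrow> real"
  where "smooth_real b" "\<And>s. s \<notin> {1<..<2} \<Longrightarrow> b s = 0" "\<And>s. 0 \<le> b s" "b (3 / 2) = 3"
proof -
  let ?b = "\<lambda>p q s. exp_poly p (s - 1) * exp_poly q (2 - s)"
  let ?S = "\<lambda>I s. \<Sum>(p, q)\<leftarrow>I. ?b p q s"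
  let ?F = "range ?S"
  \<comment> \<open>At 3/2 both arguments equal 1/2, so each exponential is exp(-2); the coefficient
    \<open>3 * exp 4\<close> makes the value there exactly 3.\<close>
  define b where "b = (\<lambda>s. ?b [:3 * exp 4:] [:1:] s)"
  have der: "\<exists>h\<in>?F. \<forall>x. (g has_real_derivative h x) (at x)" if "g \<in> ?F" for g
  proof -
    obtain I where g: "g = ?S I" using \<open>g \<in> ?F\<close> by (rule rangeE)
    let ?d = "\<lambda>p. [:0, 0, 1:] * (p - pderiv p) :: real poly"
    \<comment> \<open>Each product contributes two terms to the derivative; the sign in the second
      comes from the reflected argument 2 - s.\<close>
    let ?J = "concat (map (\<lambda>(p, q). [(?d p, q), (p, - ?d q)]) I)"
    have one: "((\<lambda>s. ?b p q s) has_real_derivative ?b (?d p) q x + ?b p (- ?d q) x) (at x)" for p q x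
    proof -
      have 1: "((\<lambda>s. exp_poly p (s - 1)) has_real_derivative exp_poly (?d p) (x - 1) * (1 - 0)) (at x)"
        by (rule DERIV_chain'[where g = "exp_poly p", OF _ exp_poly_has_derivative])
           (auto intro!: derivative_eq_intros)
      have 2: "((\<lambda>s. exp_poly q (2 - s)) has_real_derivative exp_poly (?d q) (2 - x) * (0 - 1)) (at x)"
        by (rule DERIV_chain'[where g = "exp_poly q", OF _ exp_poly_has_derivative])
           (auto intro!: derivative_eq_intros)
      have 3: "exp_poly (- r) z = - exp_poly r z" for r z by (simp add: exp_poly_def)
      show ?thesis
        using DERIV_mult[OF 1 2] unfolding 3 by (simp add: algebra_simps)
    qed
    have "(g has_real_derivative ?S ?J x) (at x)" for x
      unfolding g
    proof (induction I)
      case (Cons a I)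
      obtain p q where a: "a = (p, q)" by force
      show ?case
        using DERIV_add[OF one[of p q x] Cons.IH] by (simp add: a add_ac)
    qed auto
    then show ?thesis by (intro bexI[of _ "?S ?J"] allI rangeI)
  qed
  have "b = ?S [([:3 * exp 4:], [:1:])]"
    by (simp add: b_def)
  then have "b \<in> ?F" by (rule range_eqI)
  then have "smooth_real b" using der by (rule smooth_real_family)
  moreover have "b (3 / 2) = 3"
  proof -
    have "exp 4 * (exp (- 2) * exp (- 2)) = (1 :: real)"
      by (simp flip: exp_add)
    then show ?thesis by (simp add: b_def exp_poly_def algebra_simps)
  qed
  moreover have "b s = 0" if "s \<notin> {1<..<2}" for s
    using that by (auto simp: b_def exp_poly_def)
  moreover have "0 \<le> b s" for s
    by (auto simp: b_def exp_poly_def)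
  ultimately show ?thesis by (intro that[of b])
qed

subsection \<open>Weak gradients and Sobolev convergence\<close>

lemma integrable_continuous_compact_support:
  fixes h :: "'a::euclidean_space \<Rightarrow> real"
  assumes cont: "continuous_on UNIV h" and K: "compact K" "\<And>x. x \<notin> K \<Longrightarrow> h x = 0"
  shows "integrable lborel h"
proof -
  obtain M where M: "\<And>x. x \<in> K \<Longrightarrow> norm (h x) \<le> M"
    using compact_continuous_image[OF continuous_on_subset[OF cont subset_UNIV] K(1)]
    by (metis bounded_iff compact_imp_bounded imageI)
  show ?thesis
  proof (rule integrableI_bounded_set[where A = K and B = M])
    show "h \<in> borel_measurable lborel" using cont by (simp add: borel_measurable_continuous_onI)
    show "emeasure lborel K < \<infinity>" using K(1) by (rule emeasure_compact_finite)
  qed (use K M in \<open>auto simp: borel_compact\<close>)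
qed

lemma lborel_integral_translate:
  fixes h :: "'a::euclidean_space \<Rightarrow> real"
  assumes "h \<in> borel_measurable borel"
  shows "(\<integral>x. h (c + x) \<partial>lborel) = (\<integral>x. h x \<partial>lborel)"
proof -
  have "(\<integral>x. h x \<partial>lborel) = (\<integral>x. h x \<partial>distr lborel borel ((+) c))"
    by (simp add: lborel_distr_plus)
  also have "\<dots> = (\<integral>x. h (c + x) \<partial>lborel)"
    by (rule integral_distr) (use assms in auto)
  finally show ?thesis by simp
qed

text \<open>The difference quotients of \<open>F\<close> in direction \<open>b\<close> have integral
  0 by translation invariance. The mean value theorem bounds them uniformly, and they live in a
  common ball, so dominated convergence transfers the value 0 to the derivative.\<close>

lemma integral_derivative_compact_support:
  fixes F :: "'a::euclidean_space \<Rightarrow> real"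
  assumes F: "\<And>x. (F has_derivative F' x) (at x)"
    and cont: "continuous_on UNIV (\<lambda>x. F' x b)"
    and K: "compact K" "\<And>x. x \<notin> K \<Longrightarrow> F x = 0"
  shows "(\<integral>x. F' x b \<partial>lborel) = 0"
proof -
  have line: "((\<lambda>s. F (x + s *\<^sub>R b)) has_real_derivative F' (x + s *\<^sub>R b) b) (at s)" for x s
  proof -
    have "((\<lambda>s. x + s *\<^sub>R b) has_derivative (\<lambda>h. h *\<^sub>R b)) (at s)"
      by (auto intro!: derivative_eq_intros)
    from has_derivative_compose[OF this F]
    have "((\<lambda>s. F (x + s *\<^sub>R b)) has_derivative (\<lambda>h. F' (x + s *\<^sub>R b) (h *\<^sub>R b))) (at s)" .
    moreover have "F' (x + s *\<^sub>R b) (h *\<^sub>R b) = F' (x + s *\<^sub>R b) b * h" for h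
      using linear_scale[OF has_derivative_linear[OF F]] by (simp add: mult.commute)
    ultimately show ?thesis by (simp add: has_field_derivative_def)
  qed
  have contF: "continuous_on UNIV F"
    using F by (meson continuous_at_imp_continuous_on has_derivative_continuous)
  have out: "F' x b = 0" if "x \<notin> K" for x
  proof -
    have "(F has_derivative (\<lambda>h. 0)) (at x)"
      by (rule has_derivative_transform_within_open[of "\<lambda>x. 0" _ _ _ "- K"])
         (use K that compact_imp_closed in auto)
    then show ?thesis using F has_derivative_unique by metis
  qed
  obtain M where M: "\<And>x. x \<in> K \<Longrightarrow> norm (F' x b) \<le> M"
    using compact_continuous_image[OF continuous_on_subset[OF cont subset_UNIV] K(1)]
    by (metis bounded_iff compact_imp_bounded imageI)
  have M': "\<bar>F' x b\<bar> \<le> \<bar>M\<bar>" for x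
    using M[of x] out[of x] by (cases "x \<in> K") auto
  obtain R where R: "\<And>x. x \<in> K \<Longrightarrow> norm x \<le> R"
    using compact_imp_bounded[OF K(1)] unfolding bounded_iff by blast
  \<comment> \<open>Steps of length at most 1 keep the supports of all quotients inside the ball of
    radius \<open>R + norm b\<close>.\<close>
  define r where "r = (\<lambda>m. inverse (real (Suc m)))"
  define q where "q = (\<lambda>m x. (F (x + r m *\<^sub>R b) - F x) / r m)"
  have r: "0 < r m" "r m \<le> 1" "r m \<noteq> 0" for m by (auto simp: r_def inverse_le_1_iff)
  have r_lim: "r \<longlonglongrightarrow> 0" unfolding r_def by (rule LIMSEQ_inverse_real_of_nat)
  have q_bound: "\<bar>q m x\<bar> \<le> \<bar>M\<bar>" for m x
  proof -
    obtain z where z: "F (x + r m *\<^sub>R b) - F (x + 0 *\<^sub>R b) = (r m - 0) * F' (x + z *\<^sub>R b) b"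
      using MVT2[of 0 "r m" "\<lambda>s. F (x + s *\<^sub>R b)" "\<lambda>s. F' (x + s *\<^sub>R b) b"] line r by blast
    then have "q m x = F' (x + z *\<^sub>R b) b" using r[of m] by (simp add: q_def)
    then show ?thesis using M' by simp
  qed
  have q_out: "q m x = 0" if "x \<notin> cball 0 (R + norm b)" for m x
  proof -
    have "norm x - norm (r m *\<^sub>R b) \<le> norm (x + r m *\<^sub>R b)"
      by (metis norm_diff_ineq)
    moreover have "norm (r m *\<^sub>R b) \<le> norm b"
      using r[of m] by (simp add: mult_left_le_one_le)
    ultimately have "x + r m *\<^sub>R b \<notin> K" "x \<notin> K"
      using R[of "x + r m *\<^sub>R b"] R[of x] that norm_ge_zero[of b] by force+
    then show ?thesis using K(2) by (simp add: q_def)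
  qed
  have meas: "F \<in> borel_measurable borel" "(\<lambda>x. F' x b) \<in> borel_measurable borel"
    using contF cont by (auto intro: borel_measurable_continuous_onI)
  have int: "integrable lborel F"
    by (rule integrable_continuous_compact_support[OF contF K])
  have q_int: "(\<integral>x. q m x \<partial>lborel) = 0" for m
  proof -
    have int': "integrable lborel (\<lambda>x. F (x + r m *\<^sub>R b))"
    proof (rule integrable_continuous_compact_support)
      show "continuous_on UNIV (\<lambda>x. F (x + r m *\<^sub>R b))"
        by (intro continuous_on_compose2[OF contF] continuous_intros) auto
      show "compact ((\<lambda>x. x - r m *\<^sub>R b) ` K)"
        by (intro compact_continuous_image continuous_intros K)
      show "F (x + r m *\<^sub>R b) = 0" if "x \<notin> (\<lambda>x. x - r m *\<^sub>R b) ` K" for x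
        using that K(2)[of "x + r m *\<^sub>R b"] by (metis add_diff_cancel imageI)
    qed
    have "(\<integral>x. F (x + r m *\<^sub>R b) \<partial>lborel) = (\<integral>x. F x \<partial>lborel)"
      using lborel_integral_translate[OF meas(1), of "r m *\<^sub>R b"] by (simp add: add.commute)
    then show ?thesis
      unfolding q_def using int int' by (simp add: Bochner_Integration.integral_diff)
  qed
  have "(\<lambda>m. \<integral>x. q m x \<partial>lborel) \<longlonglongrightarrow> (\<integral>x. F' x b \<partial>lborel)"
  proof (rule integral_dominated_convergence)
    show "integrable lborel (\<lambda>x. indicator (cball 0 (R + norm b)) x * \<bar>M\<bar> :: real)"
      by (intro integrable_mult_left integrable_real_indicator)
         (use emeasure_compact_finite[OF compact_cball] in auto)
    show "AE x in lborel. (\<lambda>m. q m x) \<longlonglongrightarrow> F' x b"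
    proof (intro AE_I2)
      fix x
      have "((\<lambda>h. (F (x + h *\<^sub>R b) - F x) / h) \<longlongrightarrow> F' x b) (at 0)"
        using line[of x 0] by (simp add: DERIV_def)
      then show "(\<lambda>m. q m x) \<longlonglongrightarrow> F' x b"
        unfolding q_def
        by (rule filterlim_compose)
           (use r r_lim in \<open>simp add: filterlim_at\<close>)
    qed
    show "AE x in lborel. norm (q m x) \<le> indicator (cball 0 (R + norm b)) x * \<bar>M\<bar>" for m
      using q_bound[of m] q_out[of _ m] by (intro AE_I2) (auto simp: indicator_def)
    have "(\<lambda>x. F (x + r m *\<^sub>R b)) \<in> borel_measurable borel" for m
      using meas(1) by measurable
    then show "q m \<in> borel_measurable lborel" for m
      unfolding q_def using meas(1) by simp
  qed (use meas in simp)
  then show ?thesis by (simp add: q_int LIMSEQ_const_iff)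
qed

lemma integral_lebesgue_on_eq_lborel:
  fixes h :: "'a::euclidean_space \<Rightarrow> real"
  assumes "h \<in> borel_measurable borel" "\<Omega> \<in> sets borel" "\<And>x. x \<notin> \<Omega> \<Longrightarrow> h x = 0"
  shows "(LINT x|lebesgue_on \<Omega>. h x) = (\<integral>x. h x \<partial>lborel)"
proof -
  have "(LINT x|lebesgue_on \<Omega>. h x) = (LINT x|lebesgue. indicator \<Omega> x *\<^sub>R h x)"
    using assms(2) by (intro integral_restrict_space) auto
  also have "(\<lambda>x. indicator \<Omega> x *\<^sub>R h x) = h"
    using assms(3) by (auto simp: fun_eq_iff indicator_def)
  also have "(LINT x|lebesgue. h x) = (\<integral>x. h x \<partial>lborel)"
    using assms(1) by (intro integral_completion) auto
  finally show ?thesis .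
qed

lemma borel_imp_lebesgue_on_measurable:
  "h \<in> borel_measurable borel \<Longrightarrow> h \<in> borel_measurable (lebesgue_on \<Omega>)"
  by (intro measurable_restrict_space1 measurable_completion) auto

lemma integrable_lebesgue_on_bounded:
  fixes h :: "'a::euclidean_space \<Rightarrow> 'b::euclidean_space"
  assumes "h \<in> borel_measurable borel" "\<Omega> \<in> lmeasurable" "\<And>x. x \<in> \<Omega> \<Longrightarrow> norm (h x) \<le> C"
  shows "integrable (lebesgue_on \<Omega>) h"
proof -
  interpret finite_measure "lebesgue_on \<Omega>"
    using assms(2) by (rule finite_measure_lebesgue_on)
  show ?thesis
    by (rule integrable_const_bound[where B = C])
       (use assms in \<open>auto intro: borel_imp_lebesgue_on_measurable\<close>)
qed

text \<open>This extracts what integration by parts uses. The derivative vanishes off the support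
  \<open>K\<close> because the function is identically 0 on the open complement.\<close>

lemma test_function_C1:
  fixes \<phi> :: "'a::euclidean_space \<Rightarrow> real"
  assumes "test_function \<Omega> \<phi>"
  obtains K where "compact K" "K \<subseteq> \<Omega>"
    "\<And>x. (\<phi> has_derivative frechet_derivative \<phi> (at x)) (at x)"
    "continuous_on UNIV \<phi>" "\<And>b. continuous_on UNIV (\<lambda>x. frechet_derivative \<phi> (at x) b)"
    "\<And>x. x \<notin> K \<Longrightarrow> \<phi> x = 0" "\<And>x b. x \<notin> K \<Longrightarrow> frechet_derivative \<phi> (at x) b = 0"
proof -
  define K where "K = closure {x. \<phi> x \<noteq> 0}"
  have K: "compact K" "K \<subseteq> \<Omega>" and "smooth_on UNIV \<phi>"
    using assms by (auto simp: test_function_def K_def)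
  then have "Ck_on 1 UNIV \<phi>" by (simp add: smooth_on_def)
  then have \<phi>: "(\<phi> has_derivative frechet_derivative \<phi> (at x)) (at x)"
    and cont\<phi>': "continuous_on UNIV (\<lambda>x. frechet_derivative \<phi> (at x) b)" for x b
    by (auto simp flip: frechet_derivative_works)
  have cont\<phi>: "continuous_on UNIV \<phi>"
    using \<phi> by (meson continuous_at_imp_continuous_on has_derivative_continuous)
  have out: "\<phi> x = 0" if "x \<notin> K" for x
    using that closure_subset[of "{x. \<phi> x \<noteq> 0}"] by (auto simp: K_def)
  have "frechet_derivative \<phi> (at x) b = 0" if "x \<notin> K" for x b
  proof -
    have "(\<phi> has_derivative (\<lambda>h. 0)) (at x)"
      by (rule has_derivative_transform_within_open[of "\<lambda>x. 0" _ _ _ "- K"])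
         (use K that out compact_imp_closed in auto)
    then show ?thesis using \<phi> has_derivative_unique by metis
  qed
  then show ?thesis using K \<phi> cont\<phi> cont\<phi>' out that by blast
qed

text \<open>The product of \<open>f\<close> with a test function has compact support, so the
  integral of its directional derivative is 0; the product rule splits this into the two sides of
  the defining identity.\<close>

lemma weak_gradient_on_C1:
  fixes f :: "'a::euclidean_space \<Rightarrow> real"
  assumes f: "\<And>x. (f has_derivative (\<lambda>h. G x \<bullet> h)) (at x)"
    and G: "continuous_on UNIV G" and \<Omega>: "open \<Omega>"
  shows "weak_gradient_on \<Omega> f G"
  unfolding weak_gradient_on_def
proof (intro conjI allI impI ballI)
  have contf: "continuous_on UNIV f"
    using f by (meson continuous_at_imp_continuous_on has_derivative_continuous)
  have loc: "locally_integrable_on \<Omega> h" if "continuous_on UNIV h"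
    for h :: "'a \<Rightarrow> 'b::euclidean_space"
    unfolding locally_integrable_on_def
  proof (intro allI impI)
    fix K :: "'a set" assume K: "compact K \<and> K \<subseteq> \<Omega>"
    obtain C where "\<And>x. x \<in> K \<Longrightarrow> norm (h x) \<le> C"
      using compact_continuous_image[OF continuous_on_subset[OF \<open>continuous_on UNIV h\<close> subset_UNIV], of K] K
      by (metis bounded_iff compact_imp_bounded imageI)
    then show "integrable (lebesgue_on K) h"
      using \<open>continuous_on UNIV h\<close> K
      by (intro integrable_lebesgue_on_bounded lmeasurable_compact borel_measurable_continuous_onI) auto
  qed
  show "locally_integrable_on \<Omega> f" "locally_integrable_on \<Omega> G"
    using loc contf G by auto
  fix \<phi> b assume "test_function \<Omega> \<phi>" and b: "b \<in> (Basis :: 'a set)"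
  obtain K where K: "compact K" "K \<subseteq> \<Omega>"
    and \<phi>: "\<And>x. (\<phi> has_derivative frechet_derivative \<phi> (at x)) (at x)"
    and cont\<phi>: "continuous_on UNIV \<phi>" "\<And>b. continuous_on UNIV (\<lambda>x. frechet_derivative \<phi> (at x) b)"
    and out: "\<And>x. x \<notin> K \<Longrightarrow> \<phi> x = 0" "\<And>x b. x \<notin> K \<Longrightarrow> frechet_derivative \<phi> (at x) b = 0"
    using test_function_C1[OF \<open>test_function \<Omega> \<phi>\<close>] by metis
  define A where "A = (\<lambda>x. f x * frechet_derivative \<phi> (at x) b)"
  define B where "B = (\<lambda>x. (G x \<bullet> b) * \<phi> x)"
  have cont: "continuous_on UNIV A" "continuous_on UNIV B"
    unfolding A_def B_def by (intro continuous_intros contf G cont\<phi>)+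
  have zero: "A x = 0" "B x = 0" if "x \<notin> K" for x
    using out that by (auto simp: A_def B_def)
  have "(\<integral>x. f x * frechet_derivative \<phi> (at x) b + (G x \<bullet> b) * \<phi> x \<partial>lborel) = 0"
  proof (rule integral_derivative_compact_support[where b = b, where F = "\<lambda>x. f x * \<phi> x" and K = K
        and F' = "\<lambda>x h. f x * frechet_derivative \<phi> (at x) h + (G x \<bullet> h) * \<phi> x"])
    show "((\<lambda>x. f x * \<phi> x) has_derivative
        (\<lambda>h. f x * frechet_derivative \<phi> (at x) h + (G x \<bullet> h) * \<phi> x)) (at x)" for x
      by (intro has_derivative_mult f \<phi>)
    show "continuous_on UNIV (\<lambda>x. f x * frechet_derivative \<phi> (at x) b + (G x \<bullet> b) * \<phi> x)"
      using continuous_on_add[OF cont] by (simp add: A_def B_def)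
  qed (use K out in auto)
  then have "(\<integral>x. A x + B x \<partial>lborel) = 0" by (simp add: A_def B_def)
  moreover have "integrable lborel A" "integrable lborel B"
    using integrable_continuous_compact_support[OF cont(1) K(1)]
      integrable_continuous_compact_support[OF cont(2) K(1)] zero by auto
  ultimately have "(\<integral>x. A x \<partial>lborel) = - (\<integral>x. B x \<partial>lborel)" by simp
  moreover have "(LINT x|lebesgue_on \<Omega>. A x) = (\<integral>x. A x \<partial>lborel)"
      "(LINT x|lebesgue_on \<Omega>. B x) = (\<integral>x. B x \<partial>lborel)"
    using zero K \<Omega> cont
    by (auto intro!: integral_lebesgue_on_eq_lborel borel_measurable_continuous_onI)
  ultimately show "(LINT x|lebesgue_on \<Omega>. f x * frechet_derivative \<phi> (at x) b)
      = - (LINT x|lebesgue_on \<Omega>. (G x \<bullet> b) * \<phi> x)"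
    by (simp add: A_def B_def)
qed

section \<open>Sobolev convergence from uniform bounds and pointwise limits\<close>

lemma Lp_norm_bounded_convergence:
  fixes h :: "nat \<Rightarrow> 'a::euclidean_space \<Rightarrow> 'b::euclidean_space"
  assumes "\<And>N. h N \<in> borel_measurable borel" "l \<in> borel_measurable borel"
    and \<Omega>: "\<Omega> \<in> lmeasurable"
    and bound: "\<And>N x. x \<in> \<Omega> \<Longrightarrow> norm (h N x) \<le> C" "\<And>x. x \<in> \<Omega> \<Longrightarrow> norm (l x) \<le> C"
    and lim: "\<And>x. x \<in> \<Omega> \<Longrightarrow> (\<lambda>N. h N x) \<longlonglongrightarrow> l x" and p: "p \<ge> 1"
  shows "(\<lambda>N. Lp_norm p \<Omega> (\<lambda>x. h N x - l x)) \<longlonglongrightarrow> 0"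
proof -
  interpret finite_measure "lebesgue_on \<Omega>"
    using \<Omega> by (rule finite_measure_lebesgue_on)
  \<comment> \<open>The two bounds \<open>C\<close> add up to \<open>2 * C\<close>, and a constant
    is an integrable majorant on a set of finite measure.\<close>
  have "(\<lambda>N. LINT x|lebesgue_on \<Omega>. norm (h N x - l x) powr p) \<longlonglongrightarrow> (LINT x|lebesgue_on \<Omega>. 0)"
  proof (rule integral_dominated_convergence[where w = "\<lambda>x. (2 * C) powr p"])
    show "(\<lambda>x. norm (h N x - l x) powr p) \<in> borel_measurable (lebesgue_on \<Omega>)" for N
      using assms(1,2) by (intro borel_imp_lebesgue_on_measurable) measurable
    show "AE x in lebesgue_on \<Omega>. (\<lambda>N. norm (h N x - l x) powr p) \<longlonglongrightarrow> 0"
    proof (intro AE_I2)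
      fix x assume "x \<in> space (lebesgue_on \<Omega>)"
      then have "(\<lambda>N. norm (h N x - l x)) \<longlonglongrightarrow> 0"
        using lim by (simp add: LIM_zero_iff tendsto_norm_zero)
      then show "(\<lambda>N. norm (h N x - l x) powr p) \<longlonglongrightarrow> 0"
        by (rule tendsto_zero_powrI) (use p in auto)
    qed
    show "AE x in lebesgue_on \<Omega>. norm (norm (h N x - l x) powr p) \<le> (2 * C) powr p" for N
    proof (intro AE_I2)
      fix x assume "x \<in> space (lebesgue_on \<Omega>)"
      then have "norm (h N x - l x) \<le> 2 * C"
        using bound[of x] norm_triangle_ineq4[of "h N x" "l x"] by (smt (verit) space_lebesgue_on)
      then show "norm (norm (h N x - l x) powr p) \<le> (2 * C) powr p"
        using p by (simp add: powr_mono2)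
    qed
  qed auto
  then have "(\<lambda>N. LINT x|lebesgue_on \<Omega>. norm (h N x - l x) powr p) \<longlonglongrightarrow> 0" by simp
  then show ?thesis
    unfolding Lp_norm_def by (rule tendsto_zero_powrI) (use p in auto)
qed

lemma in_Lp_bounded:
  fixes h :: "'a::euclidean_space \<Rightarrow> 'b::euclidean_space"
  assumes "h \<in> borel_measurable borel" "\<Omega> \<in> lmeasurable" "\<And>x. x \<in> \<Omega> \<Longrightarrow> norm (h x) \<le> C" "p \<ge> 1"
  shows "in_Lp p \<Omega> h"
  unfolding in_Lp_def
proof
  show "integrable (lebesgue_on \<Omega>) (\<lambda>x. norm (h x) powr p)"
    by (rule integrable_lebesgue_on_bounded[where C = "C powr p"])
       (use assms in \<open>auto intro: powr_mono2\<close>)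
qed (use assms in \<open>auto intro: borel_imp_lebesgue_on_measurable\<close>)

text \<open>A test function and its derivatives are bounded, so both sides of the integral identity
  pass to the limit by dominated convergence. Thus \<open>H\<close> is identified as a weak gradient
  although \<open>g\<close> is only known as a pointwise limit.\<close>

lemma weak_gradient_on_bounded_limit:
  fixes f :: "nat \<Rightarrow> 'a::euclidean_space \<Rightarrow> real"
  assumes wg: "\<And>N. weak_gradient_on \<Omega> (f N) (G N)"
    and meas: "\<And>N. f N \<in> borel_measurable borel" "\<And>N. G N \<in> borel_measurable borel"
      "g \<in> borel_measurable borel" "H \<in> borel_measurable borel"
    and \<Omega>: "\<Omega> \<in> lmeasurable" "open \<Omega>"
    and bound: "\<And>N x. x \<in> \<Omega> \<Longrightarrow> \<bar>f N x\<bar> \<le> C" "\<And>N x. x \<in> \<Omega> \<Longrightarrow> norm (G N x) \<le> C"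
    and lim: "\<And>x. x \<in> \<Omega> \<Longrightarrow> (\<lambda>N. f N x) \<longlonglongrightarrow> g x" "\<And>x. x \<in> \<Omega> \<Longrightarrow> (\<lambda>N. G N x) \<longlonglongrightarrow> H x"
  shows "weak_gradient_on \<Omega> g H"
  unfolding weak_gradient_on_def
proof (intro conjI allI impI ballI)
  have bound': "\<bar>g x\<bar> \<le> C" "norm (H x) \<le> C" if "x \<in> \<Omega>" for x
    using LIMSEQ_le_const2[OF tendsto_rabs[OF lim(1)[OF that]], of C]
      LIMSEQ_le_const2[OF tendsto_norm[OF lim(2)[OF that]], of C] bound that by auto
  show "locally_integrable_on \<Omega> g" "locally_integrable_on \<Omega> H"
    unfolding locally_integrable_on_def
    using bound' by (auto intro!: integrable_lebesgue_on_bounded[where C = C] meas lmeasurable_compact)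
  fix \<phi> b assume tf: "test_function \<Omega> \<phi>" and b: "b \<in> (Basis :: 'a set)"
  define \<phi>' where "\<phi>' = (\<lambda>x. frechet_derivative \<phi> (at x) b)"
  obtain K where K: "compact K"
    and cont\<phi>: "continuous_on UNIV \<phi>" and cont\<phi>': "continuous_on UNIV \<phi>'"
    and out: "\<And>x. x \<notin> K \<Longrightarrow> \<phi> x = 0" "\<And>x. x \<notin> K \<Longrightarrow> \<phi>' x = 0"
    using test_function_C1[OF tf] unfolding \<phi>'_def by metis
  obtain D1 where D1: "\<And>x. x \<in> K \<Longrightarrow> norm (\<phi> x) \<le> D1"
    using compact_continuous_image[OF continuous_on_subset[OF cont\<phi> subset_UNIV] K]
    by (metis bounded_iff compact_imp_bounded imageI)
  obtain D2 where D2: "\<And>x. x \<in> K \<Longrightarrow> norm (\<phi>' x) \<le> D2"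
    using compact_continuous_image[OF continuous_on_subset[OF cont\<phi>' subset_UNIV] K]
    by (metis bounded_iff compact_imp_bounded imageI)
  have D: "\<bar>\<phi> x\<bar> \<le> \<bar>D1\<bar>" "\<bar>\<phi>' x\<bar> \<le> \<bar>D2\<bar>" for x
    using D1[of x] D2[of x] out[of x] by (cases "x \<in> K"; force)+
  have m\<phi>: "\<phi> \<in> borel_measurable borel" "\<phi>' \<in> borel_measurable borel"
    using cont\<phi> cont\<phi>' by (auto intro: borel_measurable_continuous_onI)
  interpret finite_measure "lebesgue_on \<Omega>"
    using \<Omega>(1) by (rule finite_measure_lebesgue_on)
  have 1: "(\<lambda>N. LINT x|lebesgue_on \<Omega>. f N x * \<phi>' x) \<longlonglongrightarrow> (LINT x|lebesgue_on \<Omega>. g x * \<phi>' x)"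
  proof (rule integral_dominated_convergence[where w = "\<lambda>x. C * \<bar>D2\<bar>"])
    show "(\<lambda>x. f N x * \<phi>' x) \<in> borel_measurable (lebesgue_on \<Omega>)"
        "(\<lambda>x. g x * \<phi>' x) \<in> borel_measurable (lebesgue_on \<Omega>)" for N
      using meas m\<phi> by (auto intro!: borel_imp_lebesgue_on_measurable)
    show "AE x in lebesgue_on \<Omega>. (\<lambda>N. f N x * \<phi>' x) \<longlonglongrightarrow> g x * \<phi>' x"
      using lim by (auto intro!: tendsto_intros AE_I2)
    show "AE x in lebesgue_on \<Omega>. norm (f N x * \<phi>' x) \<le> C * \<bar>D2\<bar>" for N
      using bound(1)[of _ N] D by (intro AE_I2) (simp add: abs_mult mult_mono')
  qed auto
  have 2: "(\<lambda>N. LINT x|lebesgue_on \<Omega>. (G N x \<bullet> b) * \<phi> x) \<longlonglongrightarrow> (LINT x|lebesgue_on \<Omega>. (H x \<bullet> b) * \<phi> x)"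
  proof (rule integral_dominated_convergence[where w = "\<lambda>x. C * \<bar>D1\<bar>"])
    show "(\<lambda>x. (G N x \<bullet> b) * \<phi> x) \<in> borel_measurable (lebesgue_on \<Omega>)"
        "(\<lambda>x. (H x \<bullet> b) * \<phi> x) \<in> borel_measurable (lebesgue_on \<Omega>)" for N
      using meas m\<phi> by (auto intro!: borel_imp_lebesgue_on_measurable)
    show "AE x in lebesgue_on \<Omega>. (\<lambda>N. (G N x \<bullet> b) * \<phi> x) \<longlonglongrightarrow> (H x \<bullet> b) * \<phi> x"
      using lim by (auto intro!: tendsto_intros AE_I2)
    show "AE x in lebesgue_on \<Omega>. norm ((G N x \<bullet> b) * \<phi> x) \<le> C * \<bar>D1\<bar>" for N
    proof (intro AE_I2)
      fix x assume "x \<in> space (lebesgue_on \<Omega>)"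
      then have "\<bar>G N x \<bullet> b\<bar> \<le> C"
        using Basis_le_norm[OF b, of "G N x"] bound(2)[of x N] by simp
      then show "norm ((G N x \<bullet> b) * \<phi> x) \<le> C * \<bar>D1\<bar>"
        using D by (simp add: abs_mult mult_mono')
    qed
  qed auto
  have "(LINT x|lebesgue_on \<Omega>. f N x * \<phi>' x) = - (LINT x|lebesgue_on \<Omega>. (G N x \<bullet> b) * \<phi> x)" for N
    using wg tf b unfolding weak_gradient_on_def \<phi>'_def by blast
  then have "(LINT x|lebesgue_on \<Omega>. g x * \<phi>' x) = - (LINT x|lebesgue_on \<Omega>. (H x \<bullet> b) * \<phi> x)"
    using LIMSEQ_unique[OF 1] tendsto_minus[OF 2] by simp
  then show "(LINT x|lebesgue_on \<Omega>. g x * frechet_derivative \<phi> (at x) b)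
      = - (LINT x|lebesgue_on \<Omega>. (H x \<bullet> b) * \<phi> x)"
    by (simp add: \<phi>'_def)
qed

text \<open>This reduces strong convergence, for every finite exponent, to uniform bounds and
  pointwise convergence of the functions and of their classical gradients.\<close>

lemma W1p_tendsto_bounded_limit:
  fixes f :: "nat \<Rightarrow> 'a::euclidean_space \<Rightarrow> real"
  assumes f: "\<And>N x. (f N has_derivative (\<lambda>h. G N x \<bullet> h)) (at x)"
    and G: "\<And>N. continuous_on UNIV (G N)"
    and meas: "g \<in> borel_measurable borel" "H \<in> borel_measurable borel"
    and \<Omega>: "\<Omega> \<in> lmeasurable" "open \<Omega>"
    and bound: "\<And>N x. x \<in> \<Omega> \<Longrightarrow> \<bar>f N x\<bar> \<le> C" "\<And>N x. x \<in> \<Omega> \<Longrightarrow> norm (G N x) \<le> C"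
    and lim: "\<And>x. x \<in> \<Omega> \<Longrightarrow> (\<lambda>N. f N x) \<longlonglongrightarrow> g x" "\<And>x. x \<in> \<Omega> \<Longrightarrow> (\<lambda>N. G N x) \<longlonglongrightarrow> H x"
    and p: "p \<ge> 1"
  shows "W1p_tendsto p \<Omega> f g"
proof -
  have bound': "\<bar>g x\<bar> \<le> C" "norm (H x) \<le> C" if "x \<in> \<Omega>" for x
    using LIMSEQ_le_const2[OF tendsto_rabs[OF lim(1)[OF that]], of C]
      LIMSEQ_le_const2[OF tendsto_norm[OF lim(2)[OF that]], of C] bound that by auto
  have wg: "weak_gradient_on \<Omega> (f N) (G N)" for N
    using f G \<Omega>(2) by (rule weak_gradient_on_C1)
  have mf: "f N \<in> borel_measurable borel" for N
    using f by (meson borel_measurable_continuous_onI continuous_at_imp_continuous_on has_derivative_continuous)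
  have mG: "G N \<in> borel_measurable borel" for N
    using G by (rule borel_measurable_continuous_onI)
  have "weak_gradient_on \<Omega> g H"
    by (rule weak_gradient_on_bounded_limit[OF wg mf mG meas \<Omega> bound lim])
  then show ?thesis
    unfolding W1p_tendsto_def
    using wg in_Lp_bounded[OF mf \<Omega>(1) _ p, where C = C] in_Lp_bounded[OF mG \<Omega>(1) _ p, where C = C]
      in_Lp_bounded[OF meas(1) \<Omega>(1) _ p, where C = C] in_Lp_bounded[OF meas(2) \<Omega>(1) _ p, where C = C]
      Lp_norm_bounded_convergence[OF mf meas(1) \<Omega>(1) _ _ lim(1) p, where C = C]
      Lp_norm_bounded_convergence[OF mG meas(2) \<Omega>(1) _ _ lim(2) p, where C = C] bound bound'
    by (intro exI[of _ G] exI[of _ H]) auto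
qed

subsection \<open>Hausdorff measure of level sets\<close>

text \<open>A finite cover becomes a sequence by appending empty sets, which have weight 0 in the
  premeasure even in dimension 0.\<close>

lemma hausdorff_premeasure_le_finite:
  fixes A :: "'a::metric_space set"
  assumes I: "finite I" and cover: "A \<subseteq> (\<Union>i\<in>I. C i)" and "\<delta> \<ge> 0"
    and C: "\<And>i. i \<in> I \<Longrightarrow> bounded (C i)" "\<And>i. i \<in> I \<Longrightarrow> diameter (C i) \<le> \<delta>"
  shows "hausdorff_premeasure d \<delta> A \<le>
    (\<Sum>i\<in>I. if C i = {} then 0 else ennreal (unit_ball_vol (real d) * (diameter (C i) / 2) ^ d))"
proof -
  obtain h where h: "bij_betw h {..<card I} I"
    using ex_bij_betw_nat_finite[OF I] by (auto simp: atLeast0LessThan)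
  define C' where "C' = (\<lambda>j. if j < card I then C (h j) else {})"
  let ?w = "\<lambda>B :: 'a set. if B = {} then 0 else ennreal (unit_ball_vol (real d) * (diameter B / 2) ^ d)"
  have hI: "h j \<in> I" if "j < card I" for j
    using h that by (auto dest: bij_betwE)
  have "hausdorff_premeasure d \<delta> A \<le> (\<Sum>j. ?w (C' j))"
    unfolding hausdorff_premeasure_def
  proof (rule INF_lower, safe)
    fix x assume "x \<in> A"
    then obtain i where i: "i \<in> I" "x \<in> C i" using cover by auto
    then obtain j where "j < card I" "h j = i"
      using h unfolding bij_betw_def by (metis imageE lessThan_iff)
    then have "x \<in> C' j" using i by (simp add: C'_def)
    then show "x \<in> (\<Union>j. C' j)" by blast
  qed (use hI C \<open>\<delta> \<ge> 0\<close> in \<open>auto simp: C'_def\<close>)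
  also have "\<dots> = (\<Sum>j<card I. ?w (C' j))"
    by (rule suminf_finite) (auto simp: C'_def)
  also have "\<dots> = (\<Sum>j<card I. ?w (C (h j)))"
    by (intro sum.cong) (auto simp: C'_def)
  also have "\<dots> = (\<Sum>i\<in>I. ?w (C i))"
    by (rule sum.reindex_bij_betw[OF h])
  finally show ?thesis .
qed

text \<open>The index of a point is obtained by rounding its coordinates down to the lattice of mesh
  4/M. Only the number of cells and the order of their diameter matter below.\<close>

lemma cube_grid:
  fixes M :: nat
  assumes "M > 0"
  obtains F :: "('n::finite \<Rightarrow> nat) set" and c :: "('n \<Rightarrow> nat) \<Rightarrow> (real ^ 'n) set"
  where "finite F" "card F = M ^ CARD('n)" "(cube :: (real ^ 'n) set) = (\<Union>f\<in>F. c f)"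
    "\<And>f x y. x \<in> c f \<Longrightarrow> y \<in> c f \<Longrightarrow> dist x y \<le> 8 * real CARD('n) / real M"
proof
  let ?F = "PiE UNIV (\<lambda>_ :: 'n. {..<M})"
  \<comment> \<open>Cells are centred at lattice points and overlap, with sides up to 8/M; summing
    over the coordinates then gives the diameter bound through the l1 norm.\<close>
  let ?c = "\<lambda>f :: 'n \<Rightarrow> nat. {x \<in> cube :: (real ^ 'n) set. \<forall>i. \<bar>(x $ i + 2) - 4 * real (f i) / real M\<bar> \<le> 4 / real M}"
  show "finite ?F" by (intro finite_PiE) auto
  show "card ?F = M ^ CARD('n)" by (simp add: card_PiE)
  show "cube = (\<Union>f\<in>?F. ?c f)"
  proof (intro set_eqI iffI)
    fix x :: "real ^ 'n" assume x: "x \<in> cube"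
    define f where "f = (\<lambda>i. nat \<lfloor>(x $ i + 2) * real M / 4\<rfloor>)"
    have r: "0 \<le> (x $ i + 2) * real M / 4" "(x $ i + 2) * real M / 4 < real M" for i
    proof -
      have "-2 < x $ i" "x $ i < 2" using x by (auto simp: cube_def)
      then show "0 \<le> (x $ i + 2) * real M / 4" "(x $ i + 2) * real M / 4 < real M"
        using assms by (auto intro!: divide_nonneg_nonneg mult_nonneg_nonneg)
    qed
    have f1: "real (f i) \<le> (x $ i + 2) * real M / 4" "(x $ i + 2) * real M / 4 < real (f i) + 1" for i
      using of_nat_floor[OF r(1)[of i]] real_of_int_floor_add_one_gt[of "(x $ i + 2) * real M / 4"]
        r(1)[of i] unfolding f_def by (linarith, simp)
    have "f i < M" for i
      using le_less_trans[OF f1(1) r(2), of i] by simp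
    then have "f \<in> ?F" by auto
    moreover have "\<bar>(x $ i + 2) - 4 * real (f i) / real M\<bar> \<le> 4 / real M" for i
    proof -
      have "4 * real (f i) / real M \<le> x $ i + 2" "x $ i + 2 \<le> 4 * real (f i) / real M + 4 / real M"
        using f1[of i] assms by (auto simp: field_simps)
      then show ?thesis by linarith
    qed
    ultimately show "x \<in> (\<Union>f\<in>?F. ?c f)" using x by blast
  qed auto
  show "dist x y \<le> 8 * real CARD('n) / real M" if "x \<in> ?c f" "y \<in> ?c f" for f x y
  proof -
    have "\<bar>(x - y) $ i\<bar> \<le> 8 / real M" for i
    proof -
      have "\<bar>(x $ i + 2) - 4 * real (f i) / real M\<bar> \<le> 4 / real M"
           "\<bar>(y $ i + 2) - 4 * real (f i) / real M\<bar> \<le> 4 / real M"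
        using that by auto
      then show ?thesis by simp
    qed
    then have "(\<Sum>i\<in>UNIV. \<bar>(x - y) $ i\<bar>) \<le> real (card (UNIV :: 'n set)) * (8 / real M)"
      by (intro sum_bounded_above) auto
    then show ?thesis
      using norm_le_l1_cart[of "x - y"] by (simp add: dist_norm mult.commute)
  qed
qed

text \<open>Eilenberg's inequality: a grid cell of diameter d meets the levels in a set of measure at most
  of order d, so the levels are covered, on average over t, by boundedly many units of d ^ (n - 1).\<close>

lemma AE_hausdorff_measure_level_set_finite:
  fixes U :: "real ^ 'n \<Rightarrow> real"
  assumes U: "L-lipschitz_on cube U"
  shows "AE t in lebesgue. hausdorff_measure (CARD('n) - 1) (level_set U t) < \<infinity>"
proof -
  let ?n = "CARD('n)"
  define d where "d = (\<lambda>m. 8 * real ?n / real (Suc m))"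
  define v where "v = unit_ball_vol (real (?n - 1))"
  \<comment> \<open>The largest weight that a set of diameter at most \<open>d m\<close> can have in
    the premeasure.\<close>
  define w where "w = (\<lambda>m. v * (d m / 2) ^ (?n - 1))"
  have L: "L \<ge> 0" using U by (rule lipschitz_on_nonneg)
  have v: "v \<ge> 0" by (simp add: v_def)
  have d: "d m > 0" for m by (simp add: d_def)
  have w: "w m \<ge> 0" for m using v d[of m] by (simp add: w_def less_imp_le)
  have "\<exists>(F :: ('n \<Rightarrow> nat) set) c. finite F \<and> card F = Suc m ^ ?n \<and> (cube :: (real ^ 'n) set) = (\<Union>f\<in>F. c f) \<and>
      (\<forall>f x y. x \<in> c f \<longrightarrow> y \<in> c f \<longrightarrow> dist x y \<le> d m)"
    for m
    using cube_grid[of "Suc m", where 'n = 'n,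
        where thesis = "\<exists>(F :: ('n \<Rightarrow> nat) set) c. finite F \<and> card F = Suc m ^ ?n \<and>
          (cube :: (real ^ 'n) set) = (\<Union>f\<in>F. c f) \<and> (\<forall>f x y. x \<in> c f \<longrightarrow> y \<in> c f \<longrightarrow> dist x y \<le> d m)"]
    unfolding d_def by blast
  then obtain F :: "nat \<Rightarrow> ('n \<Rightarrow> nat) set" and c :: "nat \<Rightarrow> ('n \<Rightarrow> nat) \<Rightarrow> (real ^ 'n) set"
    where F: "\<And>m. finite (F m)" "\<And>m. card (F m) = Suc m ^ ?n"
      "\<And>m. (cube :: (real ^ 'n) set) = (\<Union>f\<in>F m. c m f)"
      "\<And>m f x y. x \<in> c m f \<Longrightarrow> y \<in> c m f \<Longrightarrow> dist x y \<le> d m"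
    by metis
  \<comment> \<open>A sample point of the cell. Its choice is arbitrary for an empty cell, which
    contains no point of any level.\<close>
  define p where "p = (\<lambda>m f. SOME x. x \<in> c m f)"
  \<comment> \<open>By the Lipschitz bound this interval of length \<open>2 * L * d m\<close>
    contains all values of \<open>U\<close> on the cell, so only cells with \<open>t\<close> in the
    interval meet the level \<open>t\<close>.\<close>
  define J where "J = (\<lambda>m f. {U (p m f) - L * d m .. U (p m f) + L * d m})"
  define g where "g = (\<lambda>m t. \<Sum>f\<in>F m. ennreal (w m) * indicator (J m f) t)"
  have J: "U x \<in> J m f" if "f \<in> F m" "x \<in> c m f" for m f x
  proof -
    have "p m f \<in> c m f" using that unfolding p_def by (metis someI)
    then have "dist (U x) (U (p m f)) \<le> L * dist x (p m f)" "dist x (p m f) \<le> d m"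
      using that F(3,4) lipschitz_onD[OF U] by blast+
    moreover have "L * dist x (p m f) \<le> L * d m"
      using calculation(2) L by (rule mult_left_mono)
    ultimately show ?thesis by (auto simp: J_def dist_real_def)
  qed
  have premeasure: "hausdorff_premeasure (?n - 1) \<delta> (level_set U t) \<le> g m t" if "d m \<le> \<delta>" for m t \<delta>
  proof -
    define C where "C = (\<lambda>f. c m f \<inter> level_set U t)"
    have diam: "diameter (C f) \<le> d m" and bdd: "bounded (C f)" for f
    proof -
      show "diameter (C f) \<le> d m"
        using F(4)[of _ m f] d[of m] by (intro diameter_le) (auto simp: C_def dist_norm)
      show "bounded (C f)"
        using F(4)[of _ m f] unfolding bounded_def C_def by blast
    qed
    have "hausdorff_premeasure (?n - 1) \<delta> (level_set U t) \<le>
      (\<Sum>f\<in>F m. if C f = {} then 0 else ennreal (unit_ball_vol (real (?n - 1)) * (diameter (C f) / 2) ^ (?n - 1)))"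
    proof (rule hausdorff_premeasure_le_finite)
      show "level_set U t \<subseteq> (\<Union>f\<in>F m. C f)"
        using F(3)[of m] by (auto simp: C_def level_set_def)
      show "diameter (C f) \<le> \<delta>" for f using diam[of f] that by simp
    qed (use F d[of m] that bdd in auto)
    also have "\<dots> \<le> g m t"
      unfolding g_def
    proof (rule sum_mono)
      fix f assume f: "f \<in> F m"
      show "(if C f = {} then 0 else ennreal (unit_ball_vol (real (?n - 1)) * (diameter (C f) / 2) ^ (?n - 1)))
          \<le> ennreal (w m) * indicator (J m f) t"
      proof (cases "C f = {}")
        case False
        then have "t \<in> J m f" using J[OF f] by (auto simp: C_def level_set_def)
        moreover have "unit_ball_vol (real (?n - 1)) * (diameter (C f) / 2) ^ (?n - 1) \<le> w m"
          unfolding w_def v_def[symmetric] using diam[of f] bdd v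
          by (intro mult_left_mono power_mono) (auto simp: diameter_ge_0)
        ultimately show ?thesis using False by (simp add: ennreal_leI)
      qed simp
    qed
    finally show ?thesis .
  qed
  \<comment> \<open>There are \<open>Suc m ^ n\<close> cells, each contributing
    \<open>w m * 2 * L * d m\<close> to the integral of \<open>g m\<close>. Since \<open>d m\<close>
    is proportional to \<open>1 / Suc m\<close>, the powers of \<open>Suc m\<close> cancel and the
    integral is the same for all \<open>m\<close>.\<close>
  define K where "K = 4 * L * v * (4 * real ?n) ^ ?n"
  have [measurable]: "g m \<in> borel_measurable lborel" for m
    unfolding g_def J_def by measurable
  have int_g: "(\<integral>\<^sup>+t. g m t \<partial>lborel) = ennreal K" for m
  proof -
    have "(\<integral>\<^sup>+t. g m t \<partial>lborel) = (\<Sum>f\<in>F m. ennreal (w m) * ennreal (2 * (L * d m)))"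
      unfolding g_def using L d[of m]
      by (subst nn_integral_sum) (auto simp: J_def nn_integral_cmult_indicator intro!: sum.cong)
    also have "\<dots> = ennreal (real (Suc m ^ ?n) * (w m * (2 * (L * d m))))"
      using w[of m] L d[of m]
      by (simp add: F(2) ennreal_mult[symmetric] ennreal_of_nat_eq_real_of_nat del: of_nat_Suc of_nat_power)
    also have "real (Suc m ^ ?n) * (w m * (2 * (L * d m))) = 4 * L * v * (real (Suc m) * (d m / 2)) ^ ?n"
    proof -
      have pow: "(d m / 2) ^ ?n = d m / 2 * (d m / 2) ^ (?n - 1)"
        by (simp add: power_eq_if)
      show ?thesis
        unfolding w_def power_mult_distrib[of "real (Suc m)"] pow of_nat_power by simp
    qed
    also have "real (Suc m) * (d m / 2) = 4 * real ?n"
      unfolding d_def by (simp del: of_nat_Suc)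
    finally show ?thesis by (simp add: K_def)
  qed
  \<comment> \<open>Fatou's lemma: the integral of the lower limit is at most \<open>K\<close>, so
    the lower limit is finite for almost every \<open>t\<close>.\<close>
  have "(\<integral>\<^sup>+t. liminf (\<lambda>m. g m t) \<partial>lborel) \<le> liminf (\<lambda>m. \<integral>\<^sup>+t. g m t \<partial>lborel)"
    by (rule nn_integral_liminf) simp
  also have "\<dots> = ennreal K" by (simp add: int_g Liminf_const)
  finally have "(\<integral>\<^sup>+t. liminf (\<lambda>m. g m t) \<partial>lborel) \<noteq> \<infinity>"
    by (auto simp: top_unique)
  then have "AE t in lborel. liminf (\<lambda>m. g m t) \<noteq> \<infinity>"
    by (intro nn_integral_noteq_infinite) auto
  then have "AE t in lebesgue. liminf (\<lambda>m. g m t) \<noteq> \<infinity>"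
    by (rule AE_completion)
  moreover have "hausdorff_measure (?n - 1) (level_set U t) \<le> liminf (\<lambda>m. g m t)" for t
    unfolding hausdorff_measure_def
  proof (rule SUP_least)
    fix \<delta> :: real assume "\<delta> \<in> {0<..}"
    then have "\<delta> > 0" by simp
    have "d \<longlonglongrightarrow> 0"
      using tendsto_mult_right_zero[OF LIMSEQ_inverse_real_of_nat, of "8 * real ?n"]
      by (simp add: d_def divide_inverse)
    then have "eventually (\<lambda>m. d m < \<delta>) sequentially"
      using \<open>\<delta> > 0\<close> by (rule order_tendstoD)
    \<comment> \<open>For fixed scale, every grid with \<open>d m\<close> below it is admissible, so
      the premeasure is below \<open>g m\<close> for all large \<open>m\<close>.\<close>
    then show "hausdorff_premeasure (?n - 1) \<delta> (level_set U t) \<le> liminf (\<lambda>m. g m t)"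
      by (intro Liminf_bounded) (elim eventually_mono, simp only: premeasure less_imp_le)
  qed
  ultimately show ?thesis
    by (auto elim!: eventually_mono simp: less_top[symmetric] top_unique)
       (metis infinity_ennreal_def le_less_trans less_top)
qed

subsection \<open>Monotonicity and connected neighborhoods\<close>

text \<open>The ray contains points outside the bounded set, and the segment from \<open>p\<close>
  to such a point is connected, so it meets the frontier.\<close>

lemma ray_meets_frontier:
  fixes p b :: "'a::euclidean_space"
  assumes V: "bounded V" "p \<in> V" and b: "b \<noteq> 0"
  obtains s where "s \<ge> 0" "p + s *\<^sub>R b \<in> frontier V"
proof -
  obtain R where R: "\<And>x. x \<in> V \<Longrightarrow> norm x \<le> R"
    using V(1) unfolding bounded_iff by blast
  define T where "T = (\<bar>R\<bar> + norm p + 1) / norm b"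
  have "norm (T *\<^sub>R b) = \<bar>R\<bar> + norm p + 1" using b by (simp add: T_def)
  then have "norm (p + T *\<^sub>R b) > R"
    using norm_diff_ineq[of "T *\<^sub>R b" p] by (simp add: add.commute)
  then have "p + T *\<^sub>R b \<notin> V" using R by force
  moreover have "T \<ge> 0" by (simp add: T_def)
  moreover have "connected ((\<lambda>s. p + s *\<^sub>R b) ` {0..T})"
    by (intro connected_continuous_image continuous_intros) auto
  moreover have "p \<in> (\<lambda>s. p + s *\<^sub>R b) ` {0..T}"
    using \<open>T \<ge> 0\<close> by (intro image_eqI[of _ _ 0]) auto
  moreover have "p + T *\<^sub>R b \<in> (\<lambda>s. p + s *\<^sub>R b) ` {0..T}"
    using \<open>T \<ge> 0\<close> by (intro image_eqI[of _ _ T]) auto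
  ultimately have "(\<lambda>s. p + s *\<^sub>R b) ` {0..T} \<inter> frontier V \<noteq> {}"
    using V(2) by (intro connected_Int_frontier) blast+
  then show ?thesis using that by auto
qed

text \<open>The ray along \<open>b\<close> reaches the frontier at a value no smaller, the opposite
  ray at one no larger. The ray may have left the domain in between: the hypothesis compares any two
  points of the domain on a common line, and the frontier of V lies in the domain.\<close>

lemma lebesgue_monotone_on_if_mono_direction:
  fixes f :: "'a::euclidean_space \<Rightarrow> real"
  assumes cont: "continuous_on \<Omega> f" and b: "b \<noteq> 0"
    and mono: "\<And>x s. x \<in> \<Omega> \<Longrightarrow> s \<ge> 0 \<Longrightarrow> x + s *\<^sub>R b \<in> \<Omega> \<Longrightarrow> f x \<le> f (x + s *\<^sub>R b)"
  shows "lebesgue_monotone_on \<Omega> f"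
  unfolding lebesgue_monotone_on_def
proof (intro conjI allI impI)
  fix V assume "open V \<and> V \<noteq> {} \<and> compact (closure V) \<and> closure V \<subseteq> \<Omega>"
  then have V: "open V" "V \<noteq> {}" "compact (closure V)" "closure V \<subseteq> \<Omega>" by auto
  have bd: "bounded V"
    by (rule bounded_subset[OF compact_imp_bounded[OF V(3)] closure_subset])
  have cV: "closure V = V \<union> frontier V" and fr: "frontier V \<subseteq> closure V"
    using closure_Un_frontier[of V] by (auto simp: frontier_def)
  have ne: "frontier V \<noteq> {}"
  proof -
    obtain p where "p \<in> V" using V(2) by blast
    then show ?thesis by (rule ray_meets_frontier[OF bd _ b]) auto
  qed
  have up: "\<exists>q\<in>frontier V. f p \<le> f q" and down: "\<exists>q\<in>frontier V. f q \<le> f p"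
    if "p \<in> closure V" for p
  proof -
    have "(\<exists>q\<in>frontier V. f p \<le> f q) \<and> (\<exists>q\<in>frontier V. f q \<le> f p)"
    proof (cases "p \<in> V")
      case True
      obtain s where s: "s \<ge> 0" "p + s *\<^sub>R b \<in> frontier V"
        using ray_meets_frontier[OF bd True b] .
      have "-b \<noteq> 0" using b by simp
      then obtain r where r: "r \<ge> 0" "p + r *\<^sub>R (- b) \<in> frontier V"
        by (rule ray_meets_frontier[OF bd True])
      have "f p \<le> f (p + s *\<^sub>R b)"
        using s fr V(4) that by (intro mono) auto
      moreover have "f (p + r *\<^sub>R (- b)) \<le> f (p + r *\<^sub>R (- b) + r *\<^sub>R b)"
        using r fr V(4) that by (intro mono) auto
      ultimately show ?thesis using s r by auto
    qed (use that cV in auto)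
    then show "\<exists>q\<in>frontier V. f p \<le> f q" "\<exists>q\<in>frontier V. f q \<le> f p" by auto
  qed
  have "compact (f ` closure V)"
    by (rule compact_continuous_image[OF continuous_on_subset[OF cont V(4)] V(3)])
  then have bd: "bounded (f ` closure V)" by (rule compact_imp_bounded)
  have bdd: "bdd_above (f ` closure V)" "bdd_below (f ` closure V)"
    by (rule bounded_imp_bdd_above[OF bd], rule bounded_imp_bdd_below[OF bd])
  have bdd': "bdd_above (f ` frontier V)" "bdd_below (f ` frontier V)"
    by (rule bdd_above_mono[OF bdd(1) image_mono[OF fr]], rule bdd_below_mono[OF bdd(2) image_mono[OF fr]])
  have neV: "closure V \<noteq> {}" using V(2) by simp
  show "Sup (f ` closure V) = Sup (f ` frontier V)"
  proof (rule antisym)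
    show "Sup (f ` closure V) \<le> Sup (f ` frontier V)"
    proof (rule cSUP_least[OF neV])
      fix p assume "p \<in> closure V"
      then obtain q where "q \<in> frontier V" "f p \<le> f q" using up by blast
      then show "f p \<le> Sup (f ` frontier V)" by (rule cSUP_upper2[OF bdd'(1)])
    qed
    show "Sup (f ` frontier V) \<le> Sup (f ` closure V)"
      by (rule cSUP_subset_mono[OF ne bdd(1) fr order_refl])
  qed
  show "Inf (f ` closure V) = Inf (f ` frontier V)"
  proof (rule antisym)
    show "Inf (f ` frontier V) \<le> Inf (f ` closure V)"
    proof (rule cINF_greatest[OF neV])
      fix p assume "p \<in> closure V"
      then obtain q where "q \<in> frontier V" "f q \<le> f p" using down by blast
      then show "Inf (f ` frontier V) \<le> f p" by (rule cINF_lower2[OF bdd'(2)])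
    qed
    show "Inf (f ` closure V) \<le> Inf (f ` frontier V)"
      by (rule cINF_superset_mono[OF ne bdd(2) fr order_refl])
  qed
qed (rule cont)

text \<open>Balls and half-balls are convex, so straight paths stay inside. The square is a convex
  function, which handles the ball, and the constraint on coordinate 0 is linear.\<close>

lemma connected_space_manifold_model:
  assumes "manifold_model m B"
  shows "connected_space (subtopology (Euclidean_space m) B)"
proof -
  obtain c r where r: "r > 0" and B: "B = euclidean_ball m c r \<or>
      m \<ge> 1 \<and> c 0 \<ge> 0 \<and> B = {x \<in> euclidean_ball m c r. x 0 \<ge> 0}"
    using assms unfolding manifold_model_def by blast
  define l where "l = (\<lambda>(x :: nat \<Rightarrow> real) y (s :: real) i. (1 - s) * x i + s * y i)"
  have Bsub: "B \<subseteq> topspace (Euclidean_space m)"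
    using B by (auto simp: euclidean_ball_def)
  have conv: "l x y s \<in> B" if "x \<in> B" "y \<in> B" "0 \<le> s" "s \<le> 1" for x y s
  proof -
    have top: "l x y s \<in> topspace (Euclidean_space m)"
    proof -
      have "x i = 0" "y i = 0" if "i \<ge> m" for i
        using Bsub \<open>x \<in> B\<close> \<open>y \<in> B\<close> that by (auto simp: topspace_Euclidean_space)
      then show ?thesis by (simp add: l_def topspace_Euclidean_space)
    qed
    have xy: "(\<Sum>i<m. (x i - c i)\<^sup>2) < r\<^sup>2" "(\<Sum>i<m. (y i - c i)\<^sup>2) < r\<^sup>2"
      using B that by (auto simp: euclidean_ball_def)
    have "(l x y s i - c i)\<^sup>2 \<le> (1 - s) * (x i - c i)\<^sup>2 + s * (y i - c i)\<^sup>2" for i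
    proof -
      have "(1 - s) * (x i - c i)\<^sup>2 + s * (y i - c i)\<^sup>2 - (l x y s i - c i)\<^sup>2
          = s * (1 - s) * (x i - y i)\<^sup>2"
        by (simp add: l_def power2_eq_square algebra_simps)
      moreover have "0 \<le> s * (1 - s) * (x i - y i)\<^sup>2" using that by simp
      ultimately show ?thesis by linarith
    qed
    then have "(\<Sum>i<m. (l x y s i - c i)\<^sup>2) \<le>
        (1 - s) * (\<Sum>i<m. (x i - c i)\<^sup>2) + s * (\<Sum>i<m. (y i - c i)\<^sup>2)"
      by (simp add: sum_distrib_left sum.distrib[symmetric] sum_mono)
    also have "\<dots> < r\<^sup>2"
      using convex_bound_lt[OF xy, of "1 - s" s] that by simp
    finally have "l x y s \<in> euclidean_ball m c r" using top by (simp add: euclidean_ball_def)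
    moreover have "l x y s 0 \<ge> 0" if "x 0 \<ge> 0" "y 0 \<ge> 0"
      using that \<open>0 \<le> s\<close> \<open>s \<le> 1\<close> by (simp add: l_def)
    ultimately show ?thesis using B that by auto
  qed
  have "path_connected_space (subtopology (Euclidean_space m) B)"
    unfolding path_connected_space_def
  proof (intro ballI)
    fix x y
    assume "x \<in> topspace (subtopology (Euclidean_space m) B)" "y \<in> topspace (subtopology (Euclidean_space m) B)"
    then have xy: "x \<in> B" "y \<in> B" by auto
    have "continuous_map (top_of_set {0..1}) (powertop_real UNIV) (l x y)"
      unfolding continuous_map_componentwise_UNIV l_def continuous_map_iff_continuous
      by (intro allI continuous_intros)
    then have "pathin (subtopology (Euclidean_space m) B) (l x y)"
      using conv[OF xy] Bsub
      by (auto simp: pathin_def Euclidean_space_def continuous_map_in_subtopology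
          topspace_Euclidean_space subset_iff)
    moreover have "l x y 0 = x" "l x y 1 = y" by (auto simp: l_def)
    ultimately show "\<exists>g. pathin (subtopology (Euclidean_space m) B) g \<and> g 0 = x \<and> g 1 = y"
      by blast
  qed
  then show ?thesis by (rule path_connected_imp_connected_space)
qed

text \<open>A manifold neighborhood N of P inside L would be connected. It contains P, which is
  outside S, and a point of L in S close to P, so it would have to cross the frontier of S, which L
  avoids.\<close>

lemma not_has_manifold_neighborhoodI:
  fixes L :: "'a::topological_space set"
  assumes sep: "\<And>W. open W \<Longrightarrow> P \<in> W \<Longrightarrow> \<exists>S. W \<inter> L \<inter> S \<noteq> {} \<and> P \<notin> S \<and> L \<inter> frontier S = {}"
  shows "\<not> has_manifold_neighborhood (top_of_set L) P"
proof
  assume "has_manifold_neighborhood (top_of_set L) P"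
  then obtain N W m B where W: "openin (top_of_set L) W" "P \<in> W" "W \<subseteq> N"
    and N: "N \<subseteq> L" and B: "manifold_model m B"
    and hom: "subtopology (top_of_set L) N homeomorphic_space subtopology (Euclidean_space m) B"
    unfolding has_manifold_neighborhood_def topspace_euclidean_subtopology by blast
  have "connected_space (subtopology (top_of_set L) N)"
    using homeomorphic_connected_space[OF hom] connected_space_manifold_model[OF B] by simp
  moreover have "subtopology (top_of_set L) N = top_of_set N"
    using N by (simp add: subtopology_subtopology Int_absorb1)
  ultimately have conn: "connected N"
    using connectedin_def[of euclidean N] by simp
  obtain O' where O': "open O'" "W = L \<inter> O'"
    using W(1) unfolding openin_open by blast
  then obtain S where S: "O' \<inter> L \<inter> S \<noteq> {}" "P \<notin> S" "L \<inter> frontier S = {}"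
    using sep[of O'] W(2) by blast
  then have "N \<inter> frontier S \<noteq> {}"
    using conn W O' by (intro connected_Int_frontier) blast+
  then show False using S N by blast
qed

subsection \<open>The construction\<close>

lemma smooth_real_ident: "smooth_real (\<lambda>s. s)"
proof (rule smooth_real_family[of _ "{\<lambda>s. s, \<lambda>s. 1, \<lambda>s. 0}"])
  show "\<exists>h\<in>{\<lambda>s. s, \<lambda>s. 1, \<lambda>s. 0}. \<forall>x. (g has_real_derivative h x) (at x)"
    if "g \<in> {\<lambda>s. s, \<lambda>s. 1, \<lambda>s. 0}" for g :: "real \<Rightarrow> real"
    using that by (auto intro!: derivative_eq_intros)
qed simp

text \<open>The intervals where \<open>2 ^ k * s\<close> lies between 1 and 2 share at most
  endpoints for different \<open>k\<close>. Closed bounds for \<open>k\<close> against strict bounds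
  for \<open>j\<close> make the lemma apply on the boundary of the k-th strip as well.\<close>

lemma dyadic_unique:
  fixes s :: real
  assumes "1 \<le> 2 ^ k * s" "2 ^ k * s \<le> 2" "1 < 2 ^ j * s" "2 ^ j * s < 2"
  shows "j = k"
proof (rule ccontr)
  assume "j \<noteq> k"
  have s: "s > 0" using assms(3) by (metis less_trans zero_less_mult_pos zero_less_numeral zero_less_one zero_less_power)
  consider "j < k" | "k < j" using \<open>j \<noteq> k\<close> by linarith
  then show False
  proof cases
    case 1
    then have "(2::real) ^ Suc j \<le> 2 ^ k" by (intro power_increasing) auto
    then have "2 ^ Suc j * s \<le> 2 ^ k * s" using s by (intro mult_right_mono) auto
    then show False using assms by simp
  next
    case 2
    then have "(2::real) ^ Suc k \<le> 2 ^ j" by (intro power_increasing) auto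
    then have "2 ^ Suc k * s \<le> 2 ^ j * s" using s by (intro mult_right_mono) auto
    then show False using assms by simp
  qed
qed

text \<open>The inner products with \<open>a\<close>, \<open>u\<close>, \<open>w\<close> stand for
  the coordinates x, y, z - y. The vectors \<open>u'\<close> and \<open>w'\<close> are dual
  directions: moving along one changes only the inner product with \<open>u\<close>, respectively
  \<open>w\<close>, among the three.\<close>

locale tube_sum =
  fixes b b' :: "real \<Rightarrow> real" and C :: real and a u w u' w' :: "'a::euclidean_space"
  assumes b_smooth: "smooth_real b"
    and b_deriv: "\<And>s. (b has_real_derivative b' s) (at s)"
    and b'_cont: "continuous_on UNIV b'"
    and b_out: "\<And>s. s \<notin> {1<..<2} \<Longrightarrow> b s = 0"
    and b_nonneg: "\<And>s. 0 \<le> b s"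
    and b_peak: "b (3 / 2) = 3"
    and b_bound: "\<And>s. \<bar>b s\<bar> \<le> C" "\<And>s. \<bar>b' s\<bar> \<le> C"
    and a: "a \<bullet> a = 1" "a \<bullet> u = 0" "a \<bullet> w = 0"
    and u': "u' \<bullet> a = 0" "u' \<bullet> u = 1" "u' \<bullet> w = 0"
    and w': "w' \<bullet> a = 0" "w' \<bullet> u = 0" "w' \<bullet> w = 1"
begin

text \<open>The amplitude \<open>(1 / 2) ^ k\<close> balances the frequency \<open>2 ^ k\<close>,
  which keeps the gradients bounded uniformly in \<open>k\<close>.\<close>

definition wave :: "nat \<Rightarrow> 'a \<Rightarrow> real" where
  "wave k x = (1 / 2) ^ k * (sin (2 ^ k * (x \<bullet> u)))\<^sup>2 * b (2 ^ k * (x \<bullet> w))"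

text \<open>The gradient of \<open>wave k\<close>, in which the inner derivatives
  \<open>2 ^ k\<close> have been cancelled against the amplitude.\<close>

definition dwave :: "nat \<Rightarrow> 'a \<Rightarrow> 'a" where
  "dwave k x = (2 * sin (2 ^ k * (x \<bullet> u)) * cos (2 ^ k * (x \<bullet> u)) * b (2 ^ k * (x \<bullet> w))) *\<^sub>R u
     + ((sin (2 ^ k * (x \<bullet> u)))\<^sup>2 * b' (2 ^ k * (x \<bullet> w))) *\<^sub>R w"

definition approx :: "nat \<Rightarrow> 'a \<Rightarrow> real" where
  "approx N x = x \<bullet> u + (x \<bullet> a + 2) * (\<Sum>k<N. wave k x)"

definition grad :: "nat \<Rightarrow> 'a \<Rightarrow> 'a" where
  "grad N x = u + (\<Sum>k<N. wave k x) *\<^sub>R a + (x \<bullet> a + 2) *\<^sub>R (\<Sum>k<N. dwave k x)"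

definition limit :: "'a \<Rightarrow> real" where
  "limit x = x \<bullet> u + (x \<bullet> a + 2) * (\<Sum>k. wave k x)"

text \<open>The termwise gradient of the series. It serves as the weak gradient of
  \<open>limit\<close> and as the pointwise limit of \<open>grad\<close>.\<close>

definition limit_grad :: "'a \<Rightarrow> 'a" where
  "limit_grad x = u + (\<Sum>k. wave k x) *\<^sub>R a + (x \<bullet> a + 2) *\<^sub>R (\<Sum>k. dwave k x)"

lemma C_nonneg: "C \<ge> 0"
  using b_bound(1)[of 0] by simp

lemma b'_out: "b' s = 0" if "s \<notin> {1<..<2}"
  \<comment> \<open>zeros of the nonnegative function b are minima\<close>
  using DERIV_local_min[OF b_deriv, of 1 s] b_nonneg b_out[OF that] by simp

lemma wave_bound: "\<bar>wave k x\<bar> \<le> C * (1 / 2) ^ k"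
proof -
  have "(1 / 2) ^ k * (sin (2 ^ k * (x \<bullet> u)))\<^sup>2 \<le> (1 / 2) ^ k * (1::real)"
    by (intro mult_left_mono) (auto simp: abs_square_le_1)
  then have "(1 / 2) ^ k * (sin (2 ^ k * (x \<bullet> u)))\<^sup>2 * \<bar>b (2 ^ k * (x \<bullet> w))\<bar> \<le> (1 / 2) ^ k * 1 * C"
    using b_bound by (intro mult_mono) auto
  then show ?thesis by (simp add: wave_def abs_mult mult.commute)
qed

lemma wave_bound': "\<bar>wave k x\<bar> \<le> C"
proof -
  have "C * (1 / 2) ^ k \<le> C * 1" using C_nonneg by (intro mult_left_mono power_le_one) auto
  then show ?thesis using wave_bound[of k x] by simp
qed

lemma wave_nonneg: "0 \<le> wave k x"
  using b_nonneg by (simp add: wave_def)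

lemma dwave_bound: "norm (dwave k x) \<le> 2 * C * norm u + C * norm w"
proof -
  let ?t = "2 ^ k * (x \<bullet> u)" and ?s = "2 ^ k * (x \<bullet> w)"
  have "\<bar>sin ?t\<bar> * \<bar>cos ?t\<bar> * \<bar>b ?s\<bar> \<le> 1 * 1 * C"
    using b_bound by (intro mult_mono) auto
  then have "2 * (\<bar>sin ?t\<bar> * \<bar>cos ?t\<bar> * \<bar>b ?s\<bar>) * norm u \<le> 2 * C * norm u"
    by (intro mult_right_mono) auto
  then have "norm ((2 * sin ?t * cos ?t * b ?s) *\<^sub>R u) \<le> 2 * C * norm u"
    by (simp add: abs_mult mult_ac)
  moreover have "(sin ?t)\<^sup>2 * \<bar>b' ?s\<bar> \<le> 1 * C"
    using b_bound by (intro mult_mono) (auto simp: abs_square_le_1)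
  then have "norm (((sin ?t)\<^sup>2 * b' ?s) *\<^sub>R w) \<le> C * norm w"
    by (auto simp: abs_mult intro!: mult_right_mono)
  ultimately show ?thesis
    unfolding dwave_def using norm_triangle_le by (metis add_mono)
qed

text \<open>The supports in \<open>x \<bullet> w\<close> are disjoint dyadic strips. If no strip
  contains the point, every term is 0 and any index will do.\<close>

lemma one_active:
  obtains k0 where "\<And>k. k \<noteq> k0 \<Longrightarrow> wave k x = 0" "\<And>k. k \<noteq> k0 \<Longrightarrow> dwave k x = 0"
proof -
  have zero: "wave k x = 0 \<and> dwave k x = 0" if "2 ^ k * (x \<bullet> w) \<notin> {1<..<2}" for k
    using b_out[OF that] b'_out[OF that] by (simp add: wave_def dwave_def)
  show ?thesis
  proof (cases "\<exists>k. 2 ^ k * (x \<bullet> w) \<in> {1<..<2}")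
    case True
    then obtain k0 where k0: "2 ^ k0 * (x \<bullet> w) \<in> {1<..<2}" by blast
    have "2 ^ k * (x \<bullet> w) \<notin> {1<..<2}" if "k \<noteq> k0" for k
      using dyadic_unique[of k0 "x \<bullet> w" k] k0 that by auto
    then show ?thesis using zero that[of k0] by blast
  next
    case False
    then show ?thesis using zero that[of 0] by blast
  qed
qed

lemma sums_wave: "(\<lambda>k. wave k x) sums (\<Sum>k. wave k x)"
  and sums_dwave: "(\<lambda>k. dwave k x) sums (\<Sum>k. dwave k x)"
proof -
  obtain k0 where "\<And>k. k \<noteq> k0 \<Longrightarrow> wave k x = 0" "\<And>k. k \<noteq> k0 \<Longrightarrow> dwave k x = 0"
    using one_active[of x] by blast
  then have "summable (\<lambda>k. wave k x)" "summable (\<lambda>k. dwave k x)"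
    by (auto intro: summable_finite[of "{k0}"])
  then show "(\<lambda>k. wave k x) sums (\<Sum>k. wave k x)" "(\<lambda>k. dwave k x) sums (\<Sum>k. dwave k x)"
    by (auto intro: summable_sums)
qed

text \<open>With a single active index \<open>k0\<close>, a partial sum is either 0 or one term, so
  the bounds for one term carry over. The tail is nonzero only if \<open>k0\<close> is at least
  \<open>N\<close>, and then it has the size of that term.\<close>

lemma sum_wave_bound: "\<bar>\<Sum>k<N. wave k x\<bar> \<le> C"
  and sum_dwave_bound: "norm (\<Sum>k<N. dwave k x) \<le> 2 * C * norm u + C * norm w"
  and suminf_wave_diff: "\<bar>(\<Sum>k. wave k x) - (\<Sum>k<N. wave k x)\<bar> \<le> C * (1 / 2) ^ N"
proof -
  obtain k0 where k0: "\<And>k. k \<noteq> k0 \<Longrightarrow> wave k x = 0" "\<And>k. k \<noteq> k0 \<Longrightarrow> dwave k x = 0"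
    using one_active[of x] by blast
  have w: "wave k x = (if k = k0 then wave k0 x else 0)" for k using k0(1) by auto
  have dw: "dwave k x = (if k = k0 then dwave k0 x else 0)" for k using k0(2) by auto
  have sw: "(\<Sum>k<N. wave k x) = (if k0 < N then wave k0 x else 0)"
    by (subst w) (simp add: sum.delta)
  have sdw: "(\<Sum>k<N. dwave k x) = (if k0 < N then dwave k0 x else 0)"
    by (subst dw) (simp add: sum.delta)
  show "\<bar>\<Sum>k<N. wave k x\<bar> \<le> C" using wave_bound'[of k0 x] C_nonneg by (simp add: sw)
  show "norm (\<Sum>k<N. dwave k x) \<le> 2 * C * norm u + C * norm w"
    using dwave_bound[of k0 x] C_nonneg by (simp add: sdw)
  have siw: "(\<Sum>k. wave k x) = wave k0 x"
    using suminf_finite[of "{k0}" "\<lambda>k. wave k x"] k0(1) by simp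
  show "\<bar>(\<Sum>k. wave k x) - (\<Sum>k<N. wave k x)\<bar> \<le> C * (1 / 2) ^ N"
  proof (cases "k0 < N")
    case False
    then have "C * (1 / 2) ^ k0 \<le> C * (1 / 2) ^ N"
      using C_nonneg by (intro mult_left_mono power_decreasing) auto
    then show ?thesis using wave_bound[of k0 x] False by (simp add: sw siw)
  qed (use C_nonneg in \<open>simp add: sw siw\<close>)
qed

section \<open>Derivatives, smoothness and convergence of the partial sums\<close>

lemma wave_has_derivative: "(wave k has_derivative (\<lambda>h. dwave k x \<bullet> h)) (at x)"
proof -
  have b: "((\<lambda>x. b (2 ^ k * (x \<bullet> w))) has_derivative (\<lambda>h. b' (2 ^ k * (x \<bullet> w)) * (2 ^ k * (h \<bullet> w)))) (at x)"
  proof -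
    have "((\<lambda>x. 2 ^ k * (x \<bullet> w)) has_derivative (\<lambda>h. 2 ^ k * (h \<bullet> w))) (at x)"
      by (auto intro!: derivative_eq_intros)
    from has_derivative_compose[OF this b_deriv[unfolded has_field_derivative_def]]
    show ?thesis .
  qed
  have s: "((\<lambda>x. (sin (2 ^ k * (x \<bullet> u)))\<^sup>2) has_derivative
      (\<lambda>h. 2 * sin (2 ^ k * (x \<bullet> u)) * cos (2 ^ k * (x \<bullet> u)) * (2 ^ k * (h \<bullet> u)))) (at x)"
    by (auto intro!: derivative_eq_intros simp: mult_ac)
  have pow: "(1 / 2) ^ k * 2 ^ k = (1 :: real)" by (simp flip: power_mult_distrib)
  have "((\<lambda>x. (1 / 2) ^ k * ((sin (2 ^ k * (x \<bullet> u)))\<^sup>2 * b (2 ^ k * (x \<bullet> w)))) has_derivative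
      (\<lambda>h. (1 / 2) ^ k * ((sin (2 ^ k * (x \<bullet> u)))\<^sup>2 * (b' (2 ^ k * (x \<bullet> w)) * (2 ^ k * (h \<bullet> w)))
        + 2 * sin (2 ^ k * (x \<bullet> u)) * cos (2 ^ k * (x \<bullet> u)) * (2 ^ k * (h \<bullet> u)) * b (2 ^ k * (x \<bullet> w))))) (at x)"
    by (intro has_derivative_mult_right has_derivative_mult s b)
  also have "(\<lambda>h. (1 / 2) ^ k * ((sin (2 ^ k * (x \<bullet> u)))\<^sup>2 * (b' (2 ^ k * (x \<bullet> w)) * (2 ^ k * (h \<bullet> w)))
        + 2 * sin (2 ^ k * (x \<bullet> u)) * cos (2 ^ k * (x \<bullet> u)) * (2 ^ k * (h \<bullet> u)) * b (2 ^ k * (x \<bullet> w))))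
     = (\<lambda>h. ((1 / 2) ^ k * 2 ^ k) * ((sin (2 ^ k * (x \<bullet> u)))\<^sup>2 * b' (2 ^ k * (x \<bullet> w)) * (h \<bullet> w)
        + 2 * sin (2 ^ k * (x \<bullet> u)) * cos (2 ^ k * (x \<bullet> u)) * (h \<bullet> u) * b (2 ^ k * (x \<bullet> w))))"
    by (simp only: algebra_simps)
  also have "\<dots> = (\<lambda>h. dwave k x \<bullet> h)"
    unfolding pow dwave_def inner_add_left inner_scaleR_left inner_commute[of w] inner_commute[of u]
    by (simp add: mult_ac add_ac)
  finally show ?thesis by (simp add: wave_def[abs_def] mult.assoc)
qed

lemma approx_has_derivative: "(approx N has_derivative (\<lambda>h. grad N x \<bullet> h)) (at x)"
proof -
  have "((\<lambda>x. x \<bullet> u + (x \<bullet> a + 2) * (\<Sum>k<N. wave k x)) has_derivative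
      (\<lambda>h. h \<bullet> u + ((x \<bullet> a + 2) * (\<Sum>k<N. dwave k x \<bullet> h) + (h \<bullet> a + 0) * (\<Sum>k<N. wave k x)))) (at x)"
    by (intro has_derivative_add has_derivative_mult has_derivative_sum wave_has_derivative
        has_derivative_inner_left has_derivative_ident has_derivative_const)
  then show ?thesis
    unfolding approx_def[abs_def] grad_def inner_add_left inner_scaleR_left inner_sum_left
      inner_commute[of u] inner_commute[of a]
    by (simp add: mult_ac add_ac)
qed

lemma continuous_on_wave: "continuous_on S (wave k)"
  by (intro continuous_at_imp_continuous_on ballI has_derivative_continuous[OF wave_has_derivative])

lemma continuous_on_grad: "continuous_on UNIV (grad N)"
proof -
  have b: "continuous_on UNIV (\<lambda>x. b (2 ^ k * (x \<bullet> w)))" for k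
    by (rule continuous_on_compose2[of UNIV b])
       (auto intro!: continuous_intros continuous_at_imp_continuous_on DERIV_isCont b_deriv)
  have b': "continuous_on UNIV (\<lambda>x. b' (2 ^ k * (x \<bullet> w)))" for k
    by (rule continuous_on_compose2[OF b'_cont]) (auto intro!: continuous_intros)
  have "continuous_on UNIV (dwave k)" for k
    unfolding dwave_def[abs_def] by (intro continuous_intros b b')
  then show ?thesis
    unfolding grad_def[abs_def]
    by (intro continuous_intros continuous_on_wave)
qed

lemma smooth_on_approx: "smooth_on S (approx N)"
proof -
  have lin: "Ck_on j UNIV (\<lambda>x. x \<bullet> v)" for j v
    using Ck_on_smooth_real_inner[OF smooth_real_ident] .
  have sin: "Ck_on j UNIV (\<lambda>x. sin (2 ^ k * (x \<bullet> u)))" for j k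
    using Ck_on_smooth_real_inner[OF smooth_real_sin, of j "2 ^ k" u] by simp
  have b: "Ck_on j UNIV (\<lambda>x. b (2 ^ k * (x \<bullet> w)))" for j k
    using Ck_on_smooth_real_inner[OF b_smooth, of j "2 ^ k *\<^sub>R w"] by simp
  have "Ck_on j UNIV (approx N)" for j
    unfolding approx_def[abs_def] wave_def power2_eq_square
    by (intro Ck_on_add Ck_on_mult Ck_on_sum Ck_on_const lin sin b)
  then show ?thesis unfolding smooth_on_def using Ck_on_subset by blast
qed

lemma approx_tendsto: "(\<lambda>N. approx N x) \<longlonglongrightarrow> limit x"
  unfolding approx_def limit_def using sums_wave[of x] by (auto simp: sums_def intro!: tendsto_intros)

lemma grad_tendsto: "(\<lambda>N. grad N x) \<longlonglongrightarrow> limit_grad x"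
  unfolding grad_def limit_grad_def using sums_wave[of x] sums_dwave[of x]
  by (auto simp: sums_def intro!: tendsto_intros)

lemma measurable_limit: "limit \<in> borel_measurable borel" "limit_grad \<in> borel_measurable borel"
proof -
  have "approx N \<in> borel_measurable borel" for N
    by (intro borel_measurable_continuous_onI continuous_at_imp_continuous_on ballI
        has_derivative_continuous[OF approx_has_derivative])
  then show "limit \<in> borel_measurable borel"
    by (rule borel_measurable_LIMSEQ_metric) (rule approx_tendsto)
  show "limit_grad \<in> borel_measurable borel"
    by (rule borel_measurable_LIMSEQ_metric[OF borel_measurable_continuous_onI[OF continuous_on_grad]])
       (rule grad_tendsto)
qed

lemma approx_bounds:
  assumes "bounded \<Omega>"
  obtains D where "D \<ge> 0" "\<And>N x. x \<in> \<Omega> \<Longrightarrow> \<bar>approx N x\<bar> \<le> D" "\<And>N x. x \<in> \<Omega> \<Longrightarrow> norm (grad N x) \<le> D"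
    "\<And>x. x \<in> \<Omega> \<Longrightarrow> \<bar>x \<bullet> a + 2\<bar> \<le> D"
proof -
  obtain R where R: "R > 0" "\<And>x. x \<in> \<Omega> \<Longrightarrow> norm x \<le> R"
    using assms unfolding bounded_pos by blast
  define A where "A = R * norm a + 2"
  define B where "B = 2 * C * norm u + C * norm w"
  define D where "D = (R * norm u + A * C) + (norm u + C * norm a + A * B) + A"
  have nonneg: "A \<ge> 0" "B \<ge> 0" "R * norm u + A * C \<ge> 0" "norm u + C * norm a + A * B \<ge> 0"
    using R(1) C_nonneg by (auto simp: A_def B_def)
  have inner: "\<bar>x \<bullet> v\<bar> \<le> R * norm v" if "x \<in> \<Omega>" for x v
    using Cauchy_Schwarz_ineq2[of x v] mult_right_mono[OF R(2)[OF that] norm_ge_zero[of v]] by linarith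
  have A: "\<bar>x \<bullet> a + 2\<bar> \<le> A" if "x \<in> \<Omega>" for x
    using inner[OF that, of a] by (simp add: A_def)
  have 1: "\<bar>approx N x\<bar> \<le> R * norm u + A * C" if "x \<in> \<Omega>" for N x
  proof -
    have "\<bar>(x \<bullet> a + 2) * (\<Sum>k<N. wave k x)\<bar> \<le> A * C"
      unfolding abs_mult using A[OF that] sum_wave_bound nonneg by (intro mult_mono) auto
    then show ?thesis using inner[OF that, of u] unfolding approx_def by linarith
  qed
  have 2: "norm (grad N x) \<le> norm u + C * norm a + A * B" if "x \<in> \<Omega>" for N x
  proof -
    have "norm ((x \<bullet> a + 2) *\<^sub>R (\<Sum>k<N. dwave k x)) \<le> A * B"
      unfolding norm_scaleR using A[OF that] sum_dwave_bound nonneg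
      by (intro mult_mono) (auto simp: B_def)
    moreover have "norm ((\<Sum>k<N. wave k x) *\<^sub>R a) \<le> C * norm a"
      unfolding norm_scaleR by (intro mult_right_mono sum_wave_bound) auto
    ultimately show ?thesis
      unfolding grad_def by (intro norm_triangle_le add_mono order_refl)
  qed
  show ?thesis
  proof (rule that[of D])
    show "D \<ge> 0" using nonneg unfolding D_def by linarith
    show "\<bar>approx N x\<bar> \<le> D" if "x \<in> \<Omega>" for N x using 1[OF that, of N] nonneg unfolding D_def by linarith
    show "norm (grad N x) \<le> D" if "x \<in> \<Omega>" for N x using 2[OF that, of N] nonneg unfolding D_def by linarith
    show "\<bar>x \<bullet> a + 2\<bar> \<le> D" if "x \<in> \<Omega>" for x using A[OF that] nonneg unfolding D_def by linarith
  qed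
qed

lemma W1p_tendsto_approx:
  assumes "bounded \<Omega>" "open \<Omega>" "p \<ge> 1"
  shows "W1p_tendsto p \<Omega> approx limit"
proof -
  obtain D where "\<And>N x. x \<in> \<Omega> \<Longrightarrow> \<bar>approx N x\<bar> \<le> D" "\<And>N x. x \<in> \<Omega> \<Longrightarrow> norm (grad N x) \<le> D"
    using approx_bounds[OF assms(1)] by metis
  moreover have "\<Omega> \<in> lmeasurable" using assms by (intro lmeasurable_open)
  ultimately show ?thesis
    using assms(2,3)
    by (intro W1p_tendsto_bounded_limit[where G = grad and H = limit_grad and C = D]
        approx_has_derivative continuous_on_grad measurable_limit approx_tendsto grad_tendsto)
qed

text \<open>Uniformly bounded gradients on a convex set give all partial sums the same Lipschitz
  constant, which survives the pointwise limit.\<close>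

lemma lipschitz_limit:
  assumes "bounded \<Omega>" "convex \<Omega>"
  shows "\<exists>L. L-lipschitz_on \<Omega> limit"
proof -
  obtain D where D: "D \<ge> 0" "\<And>N x. x \<in> \<Omega> \<Longrightarrow> norm (grad N x) \<le> D"
    using approx_bounds[OF assms(1)] by metis
  have "dist (limit x) (limit y) \<le> D * dist x y" if "x \<in> \<Omega>" "y \<in> \<Omega>" for x y
  proof (rule LIMSEQ_le_const2)
    show "(\<lambda>N. dist (approx N x) (approx N y)) \<longlonglongrightarrow> dist (limit x) (limit y)"
      by (intro tendsto_dist approx_tendsto)
    have "dist (approx N x) (approx N y) \<le> D * dist x y" for N
      unfolding dist_norm
    proof (rule differentiable_bound[OF assms(2)])
      show "(approx N has_derivative (\<lambda>h. grad N z \<bullet> h)) (at z within \<Omega>)" for z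
        using approx_has_derivative by (rule has_derivative_at_withinI)
      show "onorm (\<lambda>h. grad N z \<bullet> h) \<le> D" if "z \<in> \<Omega>" for z
      proof (rule onorm_le)
        show "norm (grad N z \<bullet> h) \<le> D * norm h" for h
          using Cauchy_Schwarz_ineq2[of "grad N z" h] mult_right_mono[OF D(2)[OF that, of N] norm_ge_zero[of h]]
          by simp
      qed
    qed (use that in auto)
    then show "\<exists>N. \<forall>n\<ge>N. dist (approx n x) (approx n y) \<le> D * dist x y" by blast
  qed
  then show ?thesis using D(1) by (meson lipschitz_onI)
qed

lemma uniform_limit_approx:
  assumes "bounded \<Omega>"
  shows "uniform_limit \<Omega> approx limit sequentially"
proof -
  obtain D where D: "D \<ge> 0" "\<And>x. x \<in> \<Omega> \<Longrightarrow> \<bar>x \<bullet> a + 2\<bar> \<le> D"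
    using approx_bounds[OF assms] by metis
  have dist: "dist (approx N x) (limit x) \<le> D * (C * (1 / 2) ^ N)" if "x \<in> \<Omega>" for N x
  proof -
    have "dist (approx N x) (limit x) = \<bar>x \<bullet> a + 2\<bar> * \<bar>(\<Sum>k. wave k x) - (\<Sum>k<N. wave k x)\<bar>"
      unfolding abs_mult[symmetric] right_diff_distrib
      by (simp add: dist_real_def approx_def limit_def abs_minus_commute)
    also have "\<dots> \<le> D * (C * (1 / 2) ^ N)"
      using D(1) D(2)[OF that] suminf_wave_diff by (intro mult_mono) auto
    finally show ?thesis .
  qed
  have lim: "(\<lambda>N. D * (C * (1 / 2) ^ N)) \<longlonglongrightarrow> 0"
    by (intro tendsto_mult_right_zero LIMSEQ_power_zero) simp
  show ?thesis
  proof (rule uniform_limitI)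
    fix \<epsilon> :: real assume "\<epsilon> > 0"
    with lim have "\<forall>\<^sub>F N in sequentially. D * (C * (1 / 2) ^ N) < \<epsilon>"
      by (rule order_tendstoD)
    then show "\<forall>\<^sub>F N in sequentially. \<forall>x\<in>\<Omega>. dist (approx N x) (limit x) < \<epsilon>"
      by (rule eventually_mono) (use dist in \<open>blast intro: le_less_trans\<close>)
  qed
qed

section \<open>Monotonicity along \<open>a\<close>\<close>

lemma wave_translate: "wave k (x + s *\<^sub>R a) = wave k x"
  using a by (simp add: wave_def inner_add_left)

text \<open>Along \<open>a\<close> the linear term and the waves are constant; only the factor
  \<open>x \<bullet> a + 2\<close> grows, and it multiplies a nonnegative sum. The sign of the
  factor itself is irrelevant.\<close>

lemma approx_mono: "s \<ge> 0 \<Longrightarrow> approx N x \<le> approx N (x + s *\<^sub>R a)"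
  using a by (simp add: approx_def wave_translate inner_add_left mult_right_mono sum_nonneg wave_nonneg)

lemma a_nonzero: "a \<noteq> 0"
  using a(1) by auto

lemma lebesgue_monotone_on_approx: "lebesgue_monotone_on \<Omega> (approx N)"
  using approx_mono
  by (intro lebesgue_monotone_on_if_mono_direction[OF _ a_nonzero] continuous_at_imp_continuous_on
      ballI has_derivative_continuous[OF approx_has_derivative])

lemma lebesgue_monotone_on_limit:
  assumes "continuous_on \<Omega> limit"
  shows "lebesgue_monotone_on \<Omega> limit"
proof (rule lebesgue_monotone_on_if_mono_direction[OF assms a_nonzero])
  show "limit x \<le> limit (x + s *\<^sub>R a)" if "s \<ge> 0" for x s
    using LIMSEQ_le[OF approx_tendsto approx_tendsto] approx_mono[OF that] by blast
qed

section \<open>Isolated pieces of the level sets\<close>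

lemma limit_eq_base: "(\<And>k. wave k x = 0) \<Longrightarrow> limit x = x \<bullet> u"
  by (simp add: limit_def)

lemma limit_eq_single:
  assumes "1 < 2 ^ k * (x \<bullet> w)" "2 ^ k * (x \<bullet> w) < 2"
  shows "limit x = x \<bullet> u + (x \<bullet> a + 2) * wave k x"
proof -
  have "wave j x = 0" if "j \<noteq> k" for j
    using dyadic_unique[of k "x \<bullet> w" j] b_out[of "2 ^ j * (x \<bullet> w)"] assms that by (auto simp: wave_def)
  then show ?thesis
    using suminf_finite[of "{k}" "\<lambda>j. wave j x"] by (simp add: limit_def)
qed

text \<open>Grid points y0, y1 at scale k bounding a cell below t such that the k-th bump lifts
  the value at some point y of the cell to t. The constant 6 is (P \<bullet> a + 2) * b (3 / 2) at P \<bullet> a = 0;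
  it suffices since the centre of the cell is at distance at most (3 * pi / 2) / 2 ^ k from t.\<close>

lemma level_piece:
  fixes t :: real
  obtains y y0 y1 where "y0 < y" "y < y1" "y1 < t" "\<bar>y - t\<bar> \<le> 8 * (1 / 2) ^ k"
    "sin (2 ^ k * y0) = 0" "sin (2 ^ k * y1) = 0"
    "y + 6 * (1 / 2) ^ k * (sin (2 ^ k * y))\<^sup>2 = t"
proof -
  define h :: real where "h = (1 / 2) ^ k"
  have h: "h > 0" "2 ^ k * h = 1" "2 ^ k * (z * h) = z" for z
    by (auto simp: h_def power_divide)
  \<comment> \<open>Subtracting 2 from the ceiling places \<open>2 ^ k * t / pi\<close> above m + 1
    and at most at m + 2, so the cell between the multiples m and m + 1 of pi ends strictly below
    \<open>t\<close>.\<close>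
  define m where "m = \<lceil>2 ^ k * t / pi\<rceil> - 2"
  have "real_of_int m + 1 < 2 ^ k * t / pi" "2 ^ k * t / pi \<le> real_of_int m + 2"
    unfolding m_def by linarith+
  then have "pi * (real_of_int m + 1) < 2 ^ k * t" "2 ^ k * t \<le> pi * (real_of_int m + 2)"
    by (simp_all add: field_simps)
  then have "pi * (real_of_int m + 1) * h < (2 ^ k * h) * t" "(2 ^ k * h) * t \<le> pi * (real_of_int m + 2) * h"
    using h(1) by (auto simp: mult_ac)
  then have t: "pi * (real_of_int m + 1) * h < t" "t \<le> pi * (real_of_int m + 2) * h"
    using h(2) by auto
  define f where "f = (\<lambda>y. y + 6 * h * (sin (2 ^ k * y))\<^sup>2)"
  define y0 where "y0 = pi * real_of_int m * h"
  define ym where "ym = pi * (real_of_int m + 1 / 2) * h"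
  define y1 where "y1 = pi * (real_of_int m + 1) * h"
  have pih: "pi * h > 0" "pi * h < 4 * h" using h(1) pi_less_4 by auto
  have ord: "y0 < ym" "ym < y1" "t - y0 \<le> 2 * (pi * h)" "t - ym \<le> 3 / 2 * (pi * h)"
    using pih t by (auto simp: y0_def ym_def y1_def algebra_simps)
  have s0: "sin (2 ^ k * y0) = 0"
    unfolding y0_def h(3) by (rule sin_npi_int)
  have s1: "sin (2 ^ k * y1) = 0"
    using sin_npi_int[of "m + 1"] unfolding y1_def h(3) by simp
  have sm: "(sin (2 ^ k * ym))\<^sup>2 = 1"
  proof -
    have "sin (2 ^ k * ym) = cos (pi * real_of_int m)"
      unfolding ym_def h(3) using sin_npi_int[of m] by (simp add: distrib_left sin_add)
    then show ?thesis using sin_npi_int[of m] sin_cos_squared_add[of "pi * real_of_int m"] by simp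
  qed
  \<comment> \<open>The sine vanishes at \<open>y0\<close>, while at the midpoint \<open>ym\<close>
    its square is 1. There \<open>f\<close> gains \<open>6 * h\<close>, more than the gap of at most
    \<open>3 / 2 * (pi * h)\<close> since pi < 4; the intermediate value theorem gives
    \<open>y\<close>.\<close>
  have "f y0 < t" using s0 t pih unfolding f_def y0_def by (simp add: algebra_simps)
  moreover have "t \<le> f ym" using sm ord pih unfolding f_def by simp
  ultimately obtain y where y: "y0 \<le> y" "y \<le> ym" "f y = t"
    using IVT'[of f y0 t ym] ord by (fastforce simp: f_def intro!: continuous_intros)
  have "y \<noteq> y0" using y \<open>f y0 < t\<close> by auto
  show ?thesis
  proof (rule that[of y0 y y1])
    show "y0 < y" "y < y1" "y1 < t" using y \<open>y \<noteq> y0\<close> ord t by (auto simp: y1_def)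
    then show "\<bar>y - t\<bar> \<le> 8 * (1 / 2) ^ k"
      using ord pih unfolding h_def[symmetric] by linarith
    show "y + 6 * (1 / 2) ^ k * (sin (2 ^ k * y))\<^sup>2 = t" using y(3) by (simp add: f_def h_def)
  qed (fact s0 s1)+
qed

text \<open>The separating sets are cylinders S over a rectangle in the coordinates
  \<open>x \<bullet> u\<close> and \<open>x \<bullet> w\<close>. On the frontier all waves vanish
  and \<open>limit\<close> equals \<open>x \<bullet> u < t\<close>, whereas the point
  \<open>q k\<close> inside S has level \<open>t\<close>; these points converge to P.\<close>

lemma not_manifold_level:
  assumes \<Omega>: "open \<Omega>" and P: "P \<in> \<Omega>" "P \<bullet> a = 0" "P \<bullet> w = 0" and t: "P \<bullet> u = t"
  defines "L \<equiv> {x \<in> \<Omega>. limit x = t}"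
  shows "P \<in> L" "\<not> has_manifold_neighborhood (top_of_set L) P"
proof -
  show "P \<in> L" using P t by (simp add: L_def limit_eq_base wave_def b_out)
  show "\<not> has_manifold_neighborhood (top_of_set L) P"
  proof (rule not_has_manifold_neighborhoodI)
    fix W assume W: "open W" "P \<in> W"
    have "\<exists>y y0 y1. y0 < y \<and> y < y1 \<and> y1 < t \<and> \<bar>y - t\<bar> \<le> 8 * (1 / 2) ^ k \<and>
        sin (2 ^ k * y0) = 0 \<and> sin (2 ^ k * y1) = 0 \<and> y + 6 * (1 / 2) ^ k * (sin (2 ^ k * y))\<^sup>2 = t" for k
      using level_piece[of t k] by metis
    then obtain y y0 y1 where y: "y0 k < y k" "y k < y1 k" "y1 k < t" "\<bar>y k - t\<bar> \<le> 8 * (1 / 2) ^ k"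
        "sin (2 ^ k * y0 k) = 0" "sin (2 ^ k * y1 k) = 0"
        "y k + 6 * (1 / 2) ^ k * (sin (2 ^ k * y k))\<^sup>2 = t" for k :: nat
      by metis
    \<comment> \<open>The displacements set \<open>x \<bullet> u\<close> to \<open>y k\<close> and
      \<open>2 ^ k * (x \<bullet> w)\<close> to 3/2, the peak of the bump, keeping
      \<open>x \<bullet> a = 0\<close>. So the factor 2 times the peak value 3 gives the constant 6
      of \<open>level_piece\<close>.\<close>
    define q where "q = (\<lambda>k. P + (y k - t) *\<^sub>R u' + (3 / 2 * (1 / 2) ^ k) *\<^sub>R w')"
    have half: "(\<lambda>k. (1 / 2) ^ k) \<longlonglongrightarrow> (0 :: real)" by (rule LIMSEQ_power_zero) simp
    have "(\<lambda>k. y k - t) \<longlonglongrightarrow> 0"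
      by (rule Lim_null_comparison[OF _ tendsto_mult_right_zero[OF half, of 8]]) (use y(4) in auto)
    then have "q \<longlonglongrightarrow> P + 0 *\<^sub>R u' + (3 / 2 * 0) *\<^sub>R w'"
      unfolding q_def by (intro tendsto_intros half)
    then have "\<forall>\<^sub>F k in sequentially. q k \<in> W \<inter> \<Omega>"
      using W \<Omega> P by (intro topological_tendstoD) auto
    then obtain k where k: "q k \<in> W" "q k \<in> \<Omega>"
      unfolding eventually_sequentially by blast
    define S where "S = {x. y0 k < x \<bullet> u \<and> x \<bullet> u < y1 k \<and> 1 < 2 ^ k * (x \<bullet> w) \<and> 2 ^ k * (x \<bullet> w) < 2}"
    have q: "q k \<bullet> a = 0" "q k \<bullet> u = y k" "q k \<bullet> w = 3 / 2 * (1 / 2) ^ k"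
      using P t u' w' by (auto simp: q_def inner_add_left)
    have kw: "2 ^ k * (q k \<bullet> w) = 3 / 2"
      unfolding q by (simp add: power_divide)
    have "q k \<in> S" unfolding S_def mem_Collect_eq kw q(2) using y by simp
    moreover have "limit (q k) = t"
    proof -
      have "limit (q k) = y k + 2 * wave k (q k)"
        using limit_eq_single[of k "q k"] kw q by simp
      also have "wave k (q k) = (1 / 2) ^ k * (sin (2 ^ k * y k))\<^sup>2 * 3"
        unfolding wave_def kw b_peak q(2) by simp
      finally show ?thesis using y(7)[of k] by simp
    qed
    moreover have "P \<notin> S" using P by (simp add: S_def)
    moreover have "L \<inter> frontier S = {}"
    proof -
      have "limit x \<noteq> t" if x: "x \<in> frontier S" for x
      proof -
        have "open S" unfolding S_def
          by (intro open_Collect_conj open_Collect_less continuous_intros)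
        let ?T = "{x. y0 k \<le> x \<bullet> u \<and> x \<bullet> u \<le> y1 k \<and> 1 \<le> 2 ^ k * (x \<bullet> w) \<and> 2 ^ k * (x \<bullet> w) \<le> 2}"
        have "closed ?T"
          by (intro closed_Collect_conj closed_Collect_le continuous_intros)
        then have "closure S \<subseteq> ?T" by (intro closure_minimal) (auto simp: S_def)
        then have T: "x \<in> ?T" and "x \<notin> S"
          using x \<open>open S\<close> by (auto simp: frontier_def interior_open)
        have "wave j x = 0" for j
        proof (cases "j = k")
          case False
          then show ?thesis
            using dyadic_unique[of k "x \<bullet> w" j] b_out[of "2 ^ j * (x \<bullet> w)"] T by (auto simp: wave_def)
        next
          case True
          \<comment> \<open>The frontier of S lies on four faces: on the first two the sine factor
            of the k-th wave is 0, on the other two its bump.\<close>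
          consider "x \<bullet> u = y0 k" | "x \<bullet> u = y1 k" | "2 ^ k * (x \<bullet> w) = 1" | "2 ^ k * (x \<bullet> w) = 2"
            using T \<open>x \<notin> S\<close> unfolding S_def by fastforce
          then show ?thesis
            by cases (use y(5,6)[of k] b_out[of 1] b_out[of 2] in \<open>simp_all add: wave_def True\<close>)
        qed
        then have "limit x = x \<bullet> u" by (rule limit_eq_base)
        then show ?thesis using T y(3)[of k] by auto
      qed
      then show ?thesis by (auto simp: L_def)
    qed
    ultimately show "\<exists>S. W \<inter> L \<inter> S \<noteq> {} \<and> P \<notin> S \<and> L \<inter> frontier S = {}"
      using k by (intro exI[of _ S]) (auto simp: L_def)
  qed
qed

end

section \<open>Choice of the bump and of coordinates\<close>

lemma cube_eq_box: "(cube :: (real ^ 'n) set) = box (\<chi> i. -2) (\<chi> i. 2)"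
  by (auto simp: cube_def mem_box_cart)

text \<open>The bump and its derivative are continuous and vanish outside (1, 2), the derivative
  because zeros of a nonnegative function are minima. Compactness of [1, 2] therefore gives one
  global bound for both.\<close>

lemma tube_sum_exists:
  fixes a u w u' w' :: "'a::euclidean_space"
  assumes "a \<bullet> a = 1" "a \<bullet> u = 0" "a \<bullet> w = 0" "u' \<bullet> a = 0" "u' \<bullet> u = 1" "u' \<bullet> w = 0"
    "w' \<bullet> a = 0" "w' \<bullet> u = 0" "w' \<bullet> w = 1"
  obtains b b' C where "tube_sum b b' C a u w u' w'"
proof -
  obtain b where b: "smooth_real b" "\<And>s. s \<notin> {1<..<2} \<Longrightarrow> b s = 0" "\<And>s. 0 \<le> b s" "b (3 / 2) = 3"
    using smooth_bump by metis
  obtain b' where b': "\<And>x. (b has_real_derivative b' x) (at x)" "continuous_on UNIV b'"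
    using smooth_real_has_derivative[OF b(1)] by metis
  have cb: "continuous_on UNIV b" using b'(1) by (meson DERIV_isCont continuous_at_imp_continuous_on)
  have b'0: "b' s = 0" if "s \<notin> {1<..<2}" for s
    using DERIV_local_min[OF b'(1), of 1 s] b(3) b(2)[OF that] by simp
  have bd: "\<exists>C. \<forall>s\<in>{1..2}. \<bar>f s\<bar> \<le> C" if "continuous_on UNIV f" for f :: "real \<Rightarrow> real"
    using compact_continuous_image[OF continuous_on_subset[OF that subset_UNIV], of "{1..2}"]
    by (metis bounded_real compact_Icc compact_imp_bounded imageI)
  obtain C1 C2 where C: "\<And>s. s \<in> {1..2} \<Longrightarrow> \<bar>b s\<bar> \<le> C1" "\<And>s. s \<in> {1..2} \<Longrightarrow> \<bar>b' s\<bar> \<le> C2"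
    using bd[OF cb] bd[OF b'(2)] by blast
  define M where "M = \<bar>C1\<bar> + \<bar>C2\<bar>"
  have "\<bar>b s\<bar> \<le> M \<and> \<bar>b' s\<bar> \<le> M" for s
    using C(1)[of s] C(2)[of s] b(2)[of s] b'0[of s]
    by (cases "s \<in> {1<..<2}") (auto simp: M_def)
  then have "tube_sum b b' M a u w u' w'"
    by (intro tube_sum.intro) (use assms b b' in auto)
  then show ?thesis by (rule that)
qed

theorem theorem5:
  fixes e :: "nat \<Rightarrow> 'n::finite"
  assumes "CARD('n) \<ge> 3"
    and "bij_betw e {1..CARD('n)} UNIV"
  shows "\<exists>U :: real ^ 'n \<Rightarrow> real.
    (\<exists>L. L-lipschitz_on cube U) \<and>
    lebesgue_monotone_on cube U \<and>
    (\<forall>t\<in>{-1<..<1}.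
       marked_point e t \<in> level_set U t \<and>
       \<not> has_manifold_neighborhood (top_of_set (level_set U t)) (marked_point e t)) \<and>
    (\<exists>U_approx :: nat \<Rightarrow> real ^ 'n \<Rightarrow> real.
       (\<forall>N. smooth_on cube (U_approx N) \<and> lebesgue_monotone_on cube (U_approx N)) \<and>
       uniform_limit cube U_approx U sequentially \<and>
       (\<forall>p\<ge>1. W1p_tendsto p cube U_approx U)) \<and>
    (AE t in lebesgue. hausdorff_measure (CARD('n) - 1) (level_set U t) < \<infinity>)"
proof -
  have "inj_on e {1..CARD('n)}" using assms(2) by (rule bij_betw_imp_inj_on)
  then have ne: "e 1 \<noteq> e 2" "e 1 \<noteq> e 3" "e 2 \<noteq> e 3"
    using assms(1) by (auto dest: inj_onD)
  define x1 x2 x3 :: "real ^ 'n" where "x1 = axis (e 1) 1" and "x2 = axis (e 2) 1" and "x3 = axis (e 3) 1"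
  have orth: "x1 \<bullet> x1 = 1" "x2 \<bullet> x2 = 1" "x3 \<bullet> x3 = 1" "x1 \<bullet> x2 = 0" "x1 \<bullet> x3 = 0" "x2 \<bullet> x3 = 0"
      "x2 \<bullet> x1 = 0" "x3 \<bullet> x1 = 0" "x3 \<bullet> x2 = 0"
    using ne by (auto simp: x1_def x2_def x3_def inner_axis_axis)
  \<comment> \<open>With w = e3 - e2, the direction dual to u = e2 is e2 + e3, which is orthogonal
    to w; the one dual to w is e3. The marked points satisfy x = 0, y = t and z - y = 0.\<close>
  obtain b b' C where "tube_sum b b' C x1 x2 (x3 - x2) (x2 + x3) x3"
    by (rule tube_sum_exists[of x1 x2 "x3 - x2" "x2 + x3" x3])
       (use orth in \<open>auto simp: inner_add_left inner_diff_right\<close>)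
  then interpret tube_sum b b' C x1 x2 "x3 - x2" "x2 + x3" x3 .
  have cube: "open (cube :: (real ^ 'n) set)" "bounded (cube :: (real ^ 'n) set)" "convex (cube :: (real ^ 'n) set)"
    by (auto simp: cube_eq_box)
  obtain L where L: "L-lipschitz_on cube limit"
    using lipschitz_limit[OF cube(2,3)] by blast
  have marked: "marked_point e t \<in> level_set limit t \<and>
      \<not> has_manifold_neighborhood (top_of_set (level_set limit t)) (marked_point e t)"
    if "t \<in> {-1<..<1}" for t
  proof -
    have "marked_point e t \<in> cube"
      using that by (auto simp: marked_point_def cube_def)
    moreover have "marked_point e t \<bullet> x1 = 0" "marked_point e t \<bullet> x2 = t" "marked_point e t \<bullet> (x3 - x2) = 0"
      using ne by (auto simp: marked_point_def x1_def x2_def x3_def inner_diff_right inner_axis)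
    ultimately show ?thesis
      using not_manifold_level[OF cube(1), of "marked_point e t" t] unfolding level_set_def by blast
  qed
  show ?thesis
  proof (rule exI[of _ limit], intro conjI ballI)
    show "\<exists>L. L-lipschitz_on cube limit" using L by blast
    show "lebesgue_monotone_on cube limit"
      using L by (intro lebesgue_monotone_on_limit lipschitz_on_continuous_on)
    show "\<exists>U_approx. (\<forall>N. smooth_on cube (U_approx N) \<and> lebesgue_monotone_on cube (U_approx N)) \<and>
        uniform_limit cube U_approx limit sequentially \<and> (\<forall>p\<ge>1. W1p_tendsto p cube U_approx limit)"
      using smooth_on_approx lebesgue_monotone_on_approx uniform_limit_approx[OF cube(2)]
        W1p_tendsto_approx[OF cube(2,1)]
      by (intro exI[of _ approx]) auto
    show "AE t in lebesgue. hausdorff_measure (CARD('n) - 1) (level_set limit t) < \<infinity>"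
      using L by (rule AE_hausdorff_measure_level_set_finite)
  qed (use marked in auto)
qed

end
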